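(* Let $m,n,p$ be positive integers with $mn \mid p$. Then \begin{equation*} \nu_{1}(K(p^{(1)},m^{(n)}))=\phi(m,n,p)-\frac{1}{12}m^{2}n^{2}+\frac{1}{12}p^{2}, \end{equation*} where \begin{equation*} \begin{split} \phi(m,n,p)=&\frac{1}{24}m^{4}n^{4}+\frac{1}{12}m^{2}n^{3} -\frac{1}{12}m^{4}n^{3}-\frac{1}{4}m^{3}n^{3}+\frac{1}{2}m^{3}n^{2}+\frac{1}{24}m^{4}n^{2} -\frac{1}{4}m^{3}n\\ &+\frac{1}{6}m^{2}n^{2}p^{2}-\frac{1}{4}p^{2}mn-\frac{3}{4}m^{2}n^{2}p +\frac{1}{12}mnp+\frac{1}{2}m^{2}np -\frac{1}{6}m^{3}n^{2}p\\ &+\frac{1}{6}m^{3}n^{3}p +\frac{1}{6}mn^{2}p . \end{split} \end{equation*}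
   Context: An outerplanar drawing of a graph $G$ is a drawing in which the vertices are placed on a circle and each edge is drawn as a straight line segment through the interior of the circle, with no more than two edges crossing at any single point. The outerplanar crossing number $\nu_1(G)$ is the minimum number of edge crossings over all outerplanar drawings of $G$. $K(p^{(1)},m^{(n)})$ denotes the complete multipartite graph with $n+1$ partite sets, one of which has $p$ vertices and the other $n$ of which have $m$ vertices each (two vertices are adjacent iff they lie in different partite sets). *)

theory Defs
  imports "HOL-Analysis.Analysis"
begin

text \<open>
  A finite simple graph is given by its vertex set \<open>V\<close> and its set \<open>E\<close> of two-element
  edges; a drawing is a placement \<open>f\<close> of the vertices in the plane.
\<close>

definition edge_interior :: "('a \<Rightarrow> complex) \<Rightarrow> 'a set \<Rightarrow> complex set" where
  "edge_interior f e = convex hull (f ` e) - f ` e"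

definition outerplanar_drawing :: "'a set \<Rightarrow> 'a set set \<Rightarrow> ('a \<Rightarrow> complex) \<Rightarrow> bool" where
  "outerplanar_drawing V E f \<longleftrightarrow>
     inj_on f V \<and>
     (\<exists>c r. r > 0 \<and> f ` V \<subseteq> sphere c r) \<and>
     (\<forall>z. finite {e \<in> E. z \<in> edge_interior f e} \<and> card {e \<in> E. z \<in> edge_interior f e} \<le> 2)"

definition crossings :: "'a set set \<Rightarrow> ('a \<Rightarrow> complex) \<Rightarrow> 'a set set set" where
  "crossings E f =
     {{e, e'} | e e'. e \<in> E \<and> e' \<in> E \<and> e \<noteq> e' \<and> edge_interior f e \<inter> edge_interior f e' \<noteq> {}}"

definition outerplanar_crossing_number :: "'a set \<Rightarrow> 'a set set \<Rightarrow> nat" where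
  "outerplanar_crossing_number V E =
     (LEAST k. \<exists>f. outerplanar_drawing V E f \<and> card (crossings E f) = k)"

text \<open>
  Complete multipartite graph with part sizes \<open>ns\<close>: vertex \<open>(i, j)\<close> is the
  \<open>j\<close>-th vertex of the \<open>i\<close>-th part.
\<close>

definition multipartite_verts :: "nat list \<Rightarrow> (nat \<times> nat) set" where
  "multipartite_verts ns = {(i, j). i < length ns \<and> j < ns ! i}"

definition multipartite_edges :: "nat list \<Rightarrow> (nat \<times> nat) set set" where
  "multipartite_edges ns =
     {{u, v} | u v. u \<in> multipartite_verts ns \<and> v \<in> multipartite_verts ns \<and> fst u \<noteq> fst v}"

definition nu1_multipartite :: "nat list \<Rightarrow> nat" where
  "nu1_multipartite ns =
     outerplanar_crossing_number (multipartite_verts ns) (multipartite_edges ns)"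

definition phi :: "real \<Rightarrow> real \<Rightarrow> real \<Rightarrow> real" where
  "phi m n p =
     1/24 * m^4 * n^4 + 1/12 * m^2 * n^3 - 1/12 * m^4 * n^3 - 1/4 * m^3 * n^3
     + 1/2 * m^3 * n^2 + 1/24 * m^4 * n^2 - 1/4 * m^3 * n
     + 1/6 * m^2 * n^2 * p^2 - 1/4 * p^2 * m * n - 3/4 * m^2 * n^2 * p
     + 1/12 * m * n * p + 1/2 * m^2 * n * p - 1/6 * m^3 * n^2 * p
     + 1/6 * m^3 * n^3 * p + 1/6 * m * n^2 * p"

end

theory Submission
  imports Defs
begin

text \<open>
  Two chords of a circle cross iff their endpoints interlace, so four vertices produce a crossing
  unless one of the two diagonals of their quadrilateral joins vertices of the same part. The number
  of crossings is thus a constant minus the number of quadruples with a monochromatic diagonal.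
  Let 0 be the part of size \<open>p\<close> and \<open>B\<close> the set of the other \<open>mn\<close> vertices. Up to quadruples with
  three vertices in one part, whose number is constant, these quadruples split into three kinds:
  two vertices of 0 alternating with two of \<open>B\<close>; two vertices of one part inside \<open>B\<close> alternating
  with two of another; and, for a vertex \<open>y\<close> and two parts \<open>i, j\<close> of size \<open>m\<close> avoiding \<open>y\<close>, two
  vertices of \<open>i\<close> separating \<open>y\<close> from a vertex of \<open>j\<close>, or the reverse.
  The first two numbers are maximal when one set is spread evenly among the gaps of the other (a sum
  of squares is subtracted from the maximum). The third, for fixed \<open>y, i, j\<close>, is maximal when \<open>i\<close> and
  \<open>j\<close> alternate. The cyclic order \<open>1, \<dots>, n, 1, \<dots>, n, \<dots>\<close> with \<open>p / (mn)\<close> vertices of 0 in each gap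
  attains all these maxima at once.
\<close>

section \<open>Interlacing pairs on a line\<close>

text \<open>The circle is cut at angle 0, so vertices become reals in \<open>[0, 2 * pi)\<close> and
  the number of vertices between two others becomes a difference of ranks. Everything is summed over
  ordered tuples: a crossing is then counted eight times, but the sums split freely over parts.
  Either of the two diagonals may be monochromatic, so the weights of the three kinds come from
  inclusion-exclusion. The third kind has to be bounded for \<open>i\<close> and \<open>j\<close>
  jointly. One of its two halves can exceed half of the joint maximum, for instance if part
  \<open>j\<close> is clustered opposite \<open>y\<close> and part \<open>i\<close> (of even size)
  is split evenly between the two sides; the other half then vanishes. In the joint count parity
  costs exactly \<open>m\<close>, which turns \<open>(2 * m ^ 3 + m) / 3\<close> into
  \<open>2 * (m ^ 3 - m) / 3\<close>. Divisibility of \<open>p\<close> by \<open>m * n\<close> is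
  what lets part 0 be spread exactly evenly. A cyclic order alone is not yet a drawing, since three
  chords might be concurrent; the optimal order is therefore placed on angles in general
  position.\<close>

definition strictly_between :: "real \<Rightarrow> real \<Rightarrow> real \<Rightarrow> bool" where
  "strictly_between a b t \<longleftrightarrow> a < t \<and> t < b \<or> b < t \<and> t < a"

text \<open>Degenerate tuples drop out by themselves: shared endpoints are excluded, and
  \<open>a = b\<close> or \<open>c = d\<close> makes both sides of the inequality agree. Hence sums
  may range over all tuples without distinctness conditions.\<close>

definition interlaced :: "real \<Rightarrow> real \<Rightarrow> real \<Rightarrow> real \<Rightarrow> bool" where
  "interlaced a b c d \<longleftrightarrow> c \<notin> {a, b} \<and> d \<notin> {a, b} \<and> strictly_between a b c \<noteq> strictly_between a b d"

lemma interlaced_swap_left: "interlaced a b c d = interlaced b a c d"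
  unfolding interlaced_def strictly_between_def by auto

lemma interlaced_swap_right: "interlaced a b c d = interlaced a b d c"
  unfolding interlaced_def strictly_between_def by auto

lemma interlaced_swap_pairs: "interlaced a b c d = interlaced c d a b"
  unfolding interlaced_def strictly_between_def by (smt (verit) insert_iff singletonD)

lemma interlaced_distinct: "interlaced a b c d \<Longrightarrow> distinct [a, b, c, d]"
  unfolding interlaced_def strictly_between_def by auto

text \<open>Of the three ways to split four points on a circle into two pairs, exactly one is the
  pair of diagonals.\<close>

lemma interlaced_three_pairings:
  assumes "distinct [a, b, c, d]"
  shows "of_bool (interlaced a b c d) + of_bool (interlaced a c b d)
    + of_bool (interlaced a d b c) = (1::real)"
proof -
  have "a \<noteq> b" "a \<noteq> c" "a \<noteq> d" "b \<noteq> c" "b \<noteq> d" "c \<noteq> d" using assms by auto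
  then show ?thesis unfolding interlaced_def strictly_between_def
    by (smt (verit) insert_iff of_bool_eq singletonD)
qed

section \<open>Sums over ranks\<close>

text \<open>The rank is strictly monotone in \<open>q\<close>, hence injective into
  \<open>{..<card X}\<close>, hence onto by counting. This replaces a sum over an unknown
  arrangement by a sum over \<open>0, ..., card X - 1\<close>.\<close>

lemma sum_rank:
  fixes q :: "'a \<Rightarrow> real" and g :: "nat \<Rightarrow> real"
  assumes "finite X" and "inj_on q X"
  shows "(\<Sum>t\<in>X. g (card {s\<in>X. q s < q t})) = (\<Sum>r<card X. g r)"
proof -
  let ?r = "\<lambda>t. card {s\<in>X. q s < q t}"
  have less: "?r s < ?r t" if "s \<in> X" "t \<in> X" "q s < q t" for s t
    by (rule psubset_card_mono) (use assms that in auto)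
  have inj: "inj_on ?r X"
  proof (rule inj_onI)
    fix s t assume *: "s \<in> X" "t \<in> X" "?r s = ?r t"
    then have "q s = q t" using less[of s t] less[of t s]
      by (cases "q s" "q t" rule: linorder_cases) auto
    then show "s = t" using * assms(2) by (meson inj_onD)
  qed
  have "?r ` X \<subseteq> {..<card X}"
  proof clarify
    fix t assume "t \<in> X"
    then show "?r t < card X" by (intro psubset_card_mono) (use assms in auto)
  qed
  then have "?r ` X = {..<card X}"
    by (intro card_subset_eq) (auto simp: card_image[OF inj])
  then have "bij_betw ?r X {..<card X}" using inj by (simp add: bij_betw_def)
  then show ?thesis by (rule sum.reindex_bij_betw)
qed

text \<open>Two triangular numbers, one for each side of \<open>r\<close>. The boundary case
  \<open>r = N\<close> matters: it is the rank of a point that lies above the whole set.\<close>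

lemma sum_abs_diff:
  assumes "r \<le> N"
  shows "(\<Sum>s<N. \<bar>real s - real r\<bar>)
    = real r * (real r + 1) / 2 + (real N - 1 - real r) * (real N - real r) / 2"
  using assms
proof (induction N rule: dec_induct)
  case base
  have "(\<Sum>s<r. \<bar>real s - real r\<bar>) = (\<Sum>s<r. real r - real s)" by (intro sum.cong) auto
  also have "\<dots> = (\<Sum>s<r. real (s + 1))"
    by (rule sum.reindex_bij_witness[of _ "\<lambda>s. r - 1 - s" "\<lambda>s. r - 1 - s"]) auto
  also have "\<dots> = real r * (real r + 1) / 2" by (induction r) (auto simp: field_simps)
  finally show ?case by simp
next
  case (step N)
  then show ?case by (simp add: field_simps)
qed

lemma sum_square_diff:
  "(\<Sum>s<N. (real s - c)\<^sup>2)
    = (real N - 1) * real N * (2 * real N - 1) / 6 - c * real N * (real N - 1) + real N * c\<^sup>2"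
  by (induction N) (auto simp: field_simps power2_eq_square)

text \<open>Independence of \<open>r\<close> reflects that \<open>d * (N - d)\<close> is a function of cyclic distance.\<close>

lemma sum_circular_products:
  assumes "r \<le> N"
  shows "(\<Sum>s<N. \<bar>real s - real r\<bar> * (real N - \<bar>real s - real r\<bar>)) = real N * ((real N)\<^sup>2 - 1) / 6"
proof -
  have "(\<Sum>s<N. \<bar>real s - real r\<bar> * (real N - \<bar>real s - real r\<bar>))
    = real N * (\<Sum>s<N. \<bar>real s - real r\<bar>) - (\<Sum>s<N. (real s - real r)\<^sup>2)"
    by (simp add: sum_distrib_left sum_subtractf algebra_simps flip: power2_eq_square)
  then show ?thesis
    unfolding sum_abs_diff[OF assms] sum_square_diff by (simp add: field_simps power2_eq_square)
qed

text \<open>The \<open>r\<close> smaller indices count \<open>+1\<close>, the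
  \<open>N - 1 - r\<close> larger ones \<open>-1\<close>.\<close>

lemma sum_sgn_diff:
  assumes "r < N"
  shows "(\<Sum>s<N. sgn (real r - real s)) = 2 * real r + 1 - real N"
proof -
  have "(\<Sum>s<N. sgn (real r - real s)) = 2 * real r + 1 - real N" if "Suc r \<le> N" for N
    using that
  proof (induction N rule: dec_induct)
    case base
    have "(\<Sum>s<r. sgn (real r - real s)) = (\<Sum>s<r. 1)" by (intro sum.cong) auto
    then show ?case by simp
  next
    case (step N)
    then show ?case by simp
  qed
  then show ?thesis using assms by simp
qed

lemma sum_odd_diff:
  "(\<Sum>s<2 * m. of_bool (odd (s + r))) = real m"
  by (induction m) auto

section \<open>Interlaced tuples over sets of points\<close>

definition below :: "('a \<Rightarrow> real) \<Rightarrow> 'a set \<Rightarrow> 'a \<Rightarrow> nat" where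
  "below q Y v = card {y\<in>Y. q y < q v}"

definition Phi :: "('a \<Rightarrow> real) \<Rightarrow> 'a set \<Rightarrow> 'a set \<Rightarrow> 'a set \<Rightarrow> 'a set \<Rightarrow> real" where
  "Phi q A B C D =
    (\<Sum>a\<in>A. \<Sum>b\<in>B. \<Sum>c\<in>C. \<Sum>d\<in>D. of_bool (interlaced (q a) (q b) (q c) (q d)))"

lemma below_mono: "finite Y \<Longrightarrow> q u \<le> q v \<Longrightarrow> below q Y u \<le> below q Y v"
  unfolding below_def by (intro card_mono) auto

lemma below_le_card: "finite Y \<Longrightarrow> below q Y v \<le> card Y"
  unfolding below_def by (intro card_mono) auto

lemma below_Un:
  assumes "finite A" "finite B" "A \<inter> B = {}"
  shows "below q (A \<union> B) v = below q A v + below q B v"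
proof -
  have "{y\<in>A \<union> B. q y < q v} = {y\<in>A. q y < q v} \<union> {y\<in>B. q y < q v}" by auto
  then show ?thesis unfolding below_def using assms by (subst card_Un_disjoint[symmetric]) auto
qed

lemma card_between:
  assumes "finite Y" "q u \<notin> q ` Y" "q v \<notin> q ` Y"
  shows "real (card {y\<in>Y. strictly_between (q u) (q v) (q y)}) = \<bar>real (below q Y u) - real (below q Y v)\<bar>"
proof -
  have *: "real (card {y\<in>Y. strictly_between (q u) (q v) (q y)}) = real (below q Y v) - real (below q Y u)"
    if "q u \<le> q v" "q u \<notin> q ` Y" for u v
  proof -
    have "{y\<in>Y. strictly_between (q u) (q v) (q y)} = {y\<in>Y. q y < q v} - {y\<in>Y. q y < q u}"
      using that(1)
    proof (intro set_eqI)
      fix y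
      have "y \<in> Y \<Longrightarrow> q y \<noteq> q u" using that(2) by (metis imageI)
      then show "y \<in> {y\<in>Y. strictly_between (q u) (q v) (q y)}
        \<longleftrightarrow> y \<in> {y\<in>Y. q y < q v} - {y\<in>Y. q y < q u}"
        using that(1) by (auto simp: strictly_between_def)
    qed
    moreover have "{y\<in>Y. q y < q u} \<subseteq> {y\<in>Y. q y < q v}" using that by auto
    ultimately show ?thesis unfolding below_def
      using assms(1) by (simp add: card_Diff_subset card_mono of_nat_diff)
  qed
  have sym: "strictly_between (q u) (q v) = strictly_between (q v) (q u)" by (auto simp: strictly_between_def fun_eq_iff)
  show ?thesis
  proof (cases "q u \<le> q v")
    case True
    then show ?thesis using *[OF True] assms below_mono[OF assms(1) True] by simp
  next
    case False
    then have "q v \<le> q u" by simp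
    from *[OF this] assms below_mono[OF assms(1) this] show ?thesis by (simp add: sym)
  qed
qed

text \<open>The chord leaves \<open>s\<close> points of \<open>Y\<close> on one side and
  \<open>card Y - s\<close> on the other; the factor 2 accounts for the order of the chosen
  pair.\<close>

lemma sum_interlaced:
  assumes "finite Y" "q u \<notin> q ` Y" "q v \<notin> q ` Y"
  defines "s \<equiv> \<bar>real (below q Y u) - real (below q Y v)\<bar>"
  shows "(\<Sum>y\<in>Y. \<Sum>z\<in>Y. of_bool (interlaced (q u) (q v) (q y) (q z))) = 2 * s * (real (card Y) - s)"
proof -
  let ?b = "\<lambda>y. of_bool (strictly_between (q u) (q v) (q y)) :: real"
  have "(\<Sum>y\<in>Y. \<Sum>z\<in>Y. of_bool (interlaced (q u) (q v) (q y) (q z)))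
     = (\<Sum>y\<in>Y. \<Sum>z\<in>Y. ?b y * (1 - ?b z) + (1 - ?b y) * ?b z)"
  proof (intro sum.cong refl)
    fix y z assume "y \<in> Y" "z \<in> Y"
    then have "q y \<notin> {q u, q v}" "q z \<notin> {q u, q v}" using assms(2,3) by (metis imageI insertE singletonD)+
    then show "of_bool (interlaced (q u) (q v) (q y) (q z)) = ?b y * (1 - ?b z) + (1 - ?b y) * ?b z"
      by (simp add: interlaced_def)
  qed
  also have "\<dots> = (\<Sum>y\<in>Y. ?b y) * (\<Sum>z\<in>Y. 1 - ?b z) + (\<Sum>y\<in>Y. 1 - ?b y) * (\<Sum>z\<in>Y. ?b z)"
    by (simp only: sum.distrib sum_product)
  also have "(\<Sum>y\<in>Y. ?b y) = s"
    using card_between[OF assms(1-3)] assms(1) by (simp add: s_def Int_def)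
  finally show ?thesis using \<open>(\<Sum>y\<in>Y. ?b y) = s\<close> by (simp add: sum_subtractf)
qed

text \<open>
  With ranks \<open>h\<close> in \<open>X\<close>, write the number of points of \<open>Y\<close> between two points of \<open>X\<close> as \<open>k h + \<delta>\<close>.
  The contribution linear in \<open>\<delta>\<close> cancels, which leaves minus the sum of the \<open>\<delta>\<^sup>2\<close>.
\<close>

lemma Phi_XXYY:
  assumes "finite X" "finite Y" "X \<inter> Y = {}" "inj_on q (X \<union> Y)"
    and card: "card Y = k * card X"
  defines "a \<equiv> real (card X)"
    and "d \<equiv> \<lambda>x. real (below q Y x) - real k * real (below q X x)"
  shows "Phi q X X Y Y = (real k)\<^sup>2 * a\<^sup>2 * (a\<^sup>2 - 1) / 3 - 2 * (\<Sum>x\<in>X. \<Sum>y\<in>X. (d x - d y)\<^sup>2)"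
proof -
  define r where "r = (\<lambda>x. real (below q X x))"
  define h where "h = (\<lambda>x y. r x - r y)"
  have injX: "inj_on q X" using assms(4) by (meson inj_on_Un)
  have notin: "q x \<notin> q ` Y" if "x \<in> X" for x
    using that assms(3,4) by (auto simp: inj_on_def)
  have strict: "below q X x < below q X y" if "x \<in> X" "y \<in> X" "q x < q y" for x y
    unfolding below_def by (rule psubset_card_mono) (use assms that in auto)
  \<comment> \<open>Ranks in \<open>X\<close> and in \<open>Y\<close> both grow with
    \<open>q\<close>, so the sign of the rank difference in \<open>X\<close> also serves for
    \<open>Y\<close>; where the counts in \<open>Y\<close> tie, both sides are 0.\<close>
  have abs: "\<bar>real (below q Y x) - real (below q Y y)\<bar>
      = sgn (h x y) * (real (below q Y x) - real (below q Y y))" if xy: "x \<in> X" "y \<in> X" for x y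
  proof (cases "x = y")
    case False
    then consider "q x < q y" | "q y < q x"
      using injX xy by (metis inj_onD linorder_neqE_linordered_idom)
    then show ?thesis
    proof cases
      case 1
      then show ?thesis
        using strict[OF xy 1] below_mono[OF assms(2), of q x y] by (simp add: h_def r_def)
    next
      case 2
      then show ?thesis
        using strict[OF xy(2,1) 2] below_mono[OF assms(2), of q y x] by (simp add: h_def r_def)
    qed
  qed simp
  have "Phi q X X Y Y = (\<Sum>x\<in>X. \<Sum>y\<in>X. 2 * (\<bar>real (below q Y x) - real (below q Y y)\<bar> *
      (real (card Y) - \<bar>real (below q Y x) - real (below q Y y)\<bar>)))"
    unfolding Phi_def using notin assms(2)
    by (intro sum.cong refl) (subst sum_interlaced, auto)
  \<comment> \<open>With \<Delta> = k h + \<delta>, |\<Delta>| = sgn(h) \<Delta> and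
    \<open>card Y = k * a\<close>, the product |\<Delta>| (k a - |\<Delta>|) is sorted by powers of
    \<delta>.\<close>
  also have "\<dots> = (\<Sum>x\<in>X. \<Sum>y\<in>X. 2 * (real k)\<^sup>2 * (\<bar>h x y\<bar> * (a - \<bar>h x y\<bar>))
      + 2 * real k * ((d x - d y) * (a * sgn (h x y) - 2 * h x y)) - 2 * (d x - d y)\<^sup>2)"
  proof (intro sum.cong refl)
    fix x y assume xy: "x \<in> X" "y \<in> X"
    define \<sigma> where "\<sigma> = sgn (h x y)"
    have e: "real (below q Y x) - real (below q Y y) = real k * h x y + (d x - d y)"
      by (simp add: d_def h_def r_def algebra_simps)
    have b: "\<bar>real (below q Y x) - real (below q Y y)\<bar> = \<sigma> * (real k * h x y + (d x - d y))"
      using abs[OF xy] by (simp only: e \<sigma>_def)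
    have E1: "\<bar>real (below q Y x) - real (below q Y y)\<bar> *
       (real (card Y) - \<bar>real (below q Y x) - real (below q Y y)\<bar>)
      = real k * a * (\<sigma> * (real k * h x y + (d x - d y))) - (real k * h x y + (d x - d y))\<^sup>2"
      using arg_cong[OF e, of "\<lambda>t. t\<^sup>2"] unfolding b[symmetric]
      by (simp add: card a_def right_diff_distrib flip: power2_eq_square)
    have E2: "\<bar>h x y\<bar> * (a - \<bar>h x y\<bar>) = a * (\<sigma> * h x y) - (h x y)\<^sup>2"
      by (auto simp: \<sigma>_def sgn_if abs_if power2_eq_square algebra_simps)
    show "2 * (\<bar>real (below q Y x) - real (below q Y y)\<bar> *
       (real (card Y) - \<bar>real (below q Y x) - real (below q Y y)\<bar>)) =
       2 * (real k)\<^sup>2 * (\<bar>h x y\<bar> * (a - \<bar>h x y\<bar>))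
      + 2 * real k * ((d x - d y) * (a * sgn (h x y) - 2 * h x y)) - 2 * (d x - d y)\<^sup>2"
      unfolding E1 E2 \<sigma>_def[symmetric] by (simp add: algebra_simps power2_eq_square)
  qed
  also have "\<dots> = 2 * (real k)\<^sup>2 * (\<Sum>x\<in>X. \<Sum>y\<in>X. \<bar>h x y\<bar> * (a - \<bar>h x y\<bar>))
      + 2 * real k * (\<Sum>x\<in>X. \<Sum>y\<in>X. (d x - d y) * (a * sgn (h x y) - 2 * h x y))
      - 2 * (\<Sum>x\<in>X. \<Sum>y\<in>X. (d x - d y)\<^sup>2)"
    by (simp add: sum.distrib sum_subtractf sum_distrib_left)
  also have "(\<Sum>x\<in>X. \<Sum>y\<in>X. \<bar>h x y\<bar> * (a - \<bar>h x y\<bar>)) = a\<^sup>2 * (a\<^sup>2 - 1) / 6"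
  proof -
    have "(\<Sum>y\<in>X. \<bar>h x y\<bar> * (a - \<bar>h x y\<bar>)) = a * (a\<^sup>2 - 1) / 6" if "x \<in> X" for x
    proof -
      have "(\<Sum>y\<in>X. \<bar>h x y\<bar> * (a - \<bar>h x y\<bar>))
        = (\<Sum>y\<in>X. (\<lambda>s. \<bar>real s - r x\<bar> * (a - \<bar>real s - r x\<bar>)) (card {s\<in>X. q s < q y}))"
        by (simp add: h_def r_def below_def abs_minus_commute)
      also have "\<dots> = (\<Sum>s<card X. \<bar>real s - r x\<bar> * (a - \<bar>real s - r x\<bar>))"
        by (rule sum_rank[OF assms(1) injX])
      also have "\<dots> = a * (a\<^sup>2 - 1) / 6"
        unfolding a_def r_def by (rule sum_circular_products) (rule below_le_card[OF assms(1)])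
      finally show ?thesis .
    qed
    then have "(\<Sum>x\<in>X. \<Sum>y\<in>X. \<bar>h x y\<bar> * (a - \<bar>h x y\<bar>)) = (\<Sum>x\<in>X. a * (a\<^sup>2 - 1) / 6)"
      by (rule sum.cong[OF refl])
    also have "\<dots> = a\<^sup>2 * (a\<^sup>2 - 1) / 6" by (simp add: a_def power2_eq_square)
    finally show ?thesis .
  qed
  \<comment> \<open>The factor of \<open>d x - d y\<close> is antisymmetric in \<open>x\<close> and
    \<open>y\<close>, and each of its rows sums to
    \<open>a * (2 * r + 1 - a) - 2 * (a * r - a * (a - 1) / 2) = 0\<close>.\<close>
  also have "(\<Sum>x\<in>X. \<Sum>y\<in>X. (d x - d y) * (a * sgn (h x y) - 2 * h x y)) = 0"
  proof -
    have z: "(\<Sum>y\<in>X. a * sgn (h x y) - 2 * h x y) = 0" if "x \<in> X" for x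
    proof -
      have lt: "below q X x < card X"
        unfolding below_def by (rule psubset_card_mono) (use assms that in auto)
      have "(\<Sum>y\<in>X. a * sgn (h x y) - 2 * h x y)
        = (\<Sum>y\<in>X. (\<lambda>s. a * sgn (r x - real s) - 2 * (r x - real s)) (card {s\<in>X. q s < q y}))"
        by (simp add: h_def r_def below_def)
      also have "\<dots> = (\<Sum>s<card X. a * sgn (r x - real s) - 2 * (r x - real s))"
        by (rule sum_rank[OF assms(1) injX])
      also have "\<dots> = a * (\<Sum>s<card X. sgn (r x - real s)) - 2 * (a * r x - (\<Sum>s<card X. real s))"
        by (simp add: sum_subtractf sum.distrib sum_distrib_left a_def algebra_simps)
      also have "(\<Sum>s<card X. sgn (r x - real s)) = 2 * r x + 1 - a"
        unfolding r_def a_def by (rule sum_sgn_diff[OF lt])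
      also have "(\<Sum>s<card X. real s) = a * (a - 1) / 2"
      proof -
        have "(\<Sum>s<N. real s) = real N * (real N - 1) / 2" for N
          by (induction N) (auto simp: field_simps)
        then show ?thesis by (simp add: a_def)
      qed
      finally show ?thesis by (simp add: field_simps)
    qed
    have anti: "a * sgn (h x y) - 2 * h x y = - (a * sgn (h y x) - 2 * h y x)" for x y
    proof -
      have "h x y = - h y x" by (simp add: h_def)
      then show ?thesis by (simp add: sgn_minus)
    qed
    have "(\<Sum>x\<in>X. \<Sum>y\<in>X. (d x - d y) * (a * sgn (h x y) - 2 * h x y))
      = (\<Sum>x\<in>X. \<Sum>y\<in>X. d x * (a * sgn (h x y) - 2 * h x y))
        - (\<Sum>x\<in>X. \<Sum>y\<in>X. d y * (a * sgn (h x y) - 2 * h x y))"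
      by (simp add: left_diff_distrib sum_subtractf)
    also have "(\<Sum>x\<in>X. \<Sum>y\<in>X. d y * (a * sgn (h x y) - 2 * h x y))
        = - (\<Sum>y\<in>X. \<Sum>x\<in>X. d y * (a * sgn (h y x) - 2 * h y x))"
    proof -
      have "(\<Sum>x\<in>X. \<Sum>y\<in>X. d y * (a * sgn (h x y) - 2 * h x y))
        = (\<Sum>y\<in>X. \<Sum>x\<in>X. d y * (a * sgn (h x y) - 2 * h x y))"
        by (rule sum.swap)
      also have "\<dots> = (\<Sum>y\<in>X. \<Sum>x\<in>X. - (d y * (a * sgn (h y x) - 2 * h y x)))"
        by (intro sum.cong refl, subst anti) (simp only: mult_minus_right)
      finally show ?thesis by (simp only: sum_negf)
    qed
    finally show ?thesis by (simp add: z flip: sum_distrib_left)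
  qed
  finally show ?thesis by (simp add: field_simps)
qed


text \<open>The circular sum does not depend on the reference rank, so \<open>y\<close> may be any
  point, inside \<open>X\<close> or outside.\<close>

lemma sum_circular_products_below:
  assumes "finite X" "inj_on q X"
  defines "N \<equiv> real (card X)"
  shows "(\<Sum>t\<in>X. \<bar>real (below q X t) - real (below q X y)\<bar> *
      (N - \<bar>real (below q X t) - real (below q X y)\<bar>)) = N * (N\<^sup>2 - 1) / 6"
proof -
  let ?g = "\<lambda>s. \<bar>real s - real (below q X y)\<bar> * (N - \<bar>real s - real (below q X y)\<bar>)"
  have "(\<Sum>t\<in>X. ?g (below q X t)) = (\<Sum>s<card X. ?g s)"
    unfolding below_def[of q X] by (rule sum_rank[OF assms(1,2)])
  also have "\<dots> = N * (N\<^sup>2 - 1) / 6"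
    unfolding N_def by (rule sum_circular_products) (rule below_le_card[OF assms(1)])
  finally show ?thesis .
qed

text \<open>The roles of the chords are exchanged: each chord from \<open>y\<close> to a point
  \<open>t\<close> of \<open>Y\<close> is fixed, and the ordered pairs of \<open>X\<close> that it
  separates are counted.\<close>

lemma Phi_XXyY:
  assumes "finite X" "finite Y" "X \<inter> Y = {}" "y \<notin> X" "y \<notin> Y" "inj_on q (insert y (X \<union> Y))"
  shows "Phi q X X {y} Y = (\<Sum>t\<in>Y. 2 * (\<bar>real (below q X t) - real (below q X y)\<bar> *
      (real (card X) - \<bar>real (below q X t) - real (below q X y)\<bar>)))"
proof -
  have notin: "q t \<notin> q ` X" if "t = y \<or> t \<in> Y" for t
    using that assms(3-6) by (auto simp: inj_on_def)
  have "Phi q X X {y} Y = (\<Sum>a\<in>X. \<Sum>b\<in>X. \<Sum>t\<in>Y. of_bool (interlaced (q t) (q y) (q a) (q b)))"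
    unfolding Phi_def
    by (simp only: interlaced_swap_pairs[of "q t" "q y" for t] interlaced_swap_right[of _ _ "q y"])
      (simp add: interlaced_swap_right)
  also have "\<dots> = (\<Sum>a\<in>X. \<Sum>t\<in>Y. \<Sum>b\<in>X. of_bool (interlaced (q t) (q y) (q a) (q b)))"
    by (intro sum.cong refl sum.swap)
  also have "\<dots> = (\<Sum>t\<in>Y. \<Sum>a\<in>X. \<Sum>b\<in>X. of_bool (interlaced (q t) (q y) (q a) (q b)))"
    by (rule sum.swap)
  also have "\<dots> = (\<Sum>t\<in>Y. 2 * (\<bar>real (below q X t) - real (below q X y)\<bar> *
      (real (card X) - \<bar>real (below q X t) - real (below q X y)\<bar>)))"
    using notin assms(1) by (intro sum.cong refl) (subst sum_interlaced, auto)
  finally show ?thesis .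
qed

text \<open>
  Each point \<open>t\<close> contributes \<open>a (m - a) + b (m - b)\<close>, where \<open>a\<close> and \<open>b\<close> count the points of \<open>X\<close> and \<open>Y\<close>
  between \<open>y\<close> and \<open>t\<close>. This depends on \<open>a + b\<close>, a rank in \<open>X \<union> Y\<close>, and on \<open>(a - b)\<^sup>2\<close>, which is at least
  the parity of \<open>a + b\<close>.
\<close>

lemma Phi_XXyY_plus_Phi_YYyX:
  assumes "finite X" "finite Y" "X \<inter> Y = {}" "y \<notin> X" "y \<notin> Y" "inj_on q (insert y (X \<union> Y))"
    and "card X = m" "card Y = m"
  defines "D \<equiv> \<lambda>v. int (below q X v) - int (below q Y v)"
  shows "Phi q X X {y} Y + Phi q Y Y {y} X = 2 * (real m ^ 3 - real m) / 3
    - (\<Sum>t\<in>X \<union> Y. real_of_int ((D t - D y)\<^sup>2) - of_bool (odd (D t - D y)))"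
proof -
  let ?Z = "X \<union> Y"
  define f where "f = (\<lambda>S t. \<bar>real (below q S t) - real (below q S y)\<bar>)"
  have injX: "inj_on q X" and injY: "inj_on q Y" and injZ: "inj_on q ?Z"
    using assms(6) by (auto simp: inj_on_def)
  have fin: "finite ?Z" and cardZ: "card ?Z = 2 * m"
    using assms by (auto simp: card_Un_disjoint)
  have split: "(\<Sum>t\<in>?Z. g t) = (\<Sum>t\<in>X. g t) + (\<Sum>t\<in>Y. g t)" for g :: "'a \<Rightarrow> real"
    using assms by (simp add: sum.union_disjoint)
  have below_Z: "below q ?Z v = below q X v + below q Y v" for v
    using assms by (intro below_Un)
  \<comment> \<open>With a and b the counts in \<open>X\<close> and \<open>Y\<close> between
    \<open>y\<close> and \<open>t\<close>, this is a (m - a) + b (m - b) = ((a + b) (2 m - a - b) -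
    (a - b)^2) / 2. In either case both absolute values open with the same sign, so a - b is
    \<open>D t - D y\<close> up to sign.\<close>
  have pt: "f X t * (m - f X t) + f Y t * (m - f Y t)
      = (f ?Z t * (2 * m - f ?Z t)) / 2 - real_of_int ((D t - D y)\<^sup>2) / 2" for t
  proof (cases "q t \<le> q y")
    case True
    from below_mono[OF assms(1) True] below_mono[OF assms(2) True] show ?thesis
      unfolding f_def below_Z D_def by (simp add: field_simps power2_eq_square)
  next
    case False
    then have "q y \<le> q t" by simp
    from below_mono[OF assms(1) this] below_mono[OF assms(2) this] show ?thesis
      unfolding f_def below_Z D_def by (simp add: field_simps power2_eq_square)
  qed
  have "Phi q X X {y} Y + Phi q Y Y {y} X
     = 2 * (\<Sum>t\<in>Y. f X t * (m - f X t)) + 2 * (\<Sum>t\<in>X. f Y t * (m - f Y t))"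
    using assms by (simp add: Phi_XXyY f_def sum_distrib_left Int_commute Un_commute)
  \<comment> \<open>Both sums are completed to all of \<open>?Z\<close>; the added sums of a class
    over its own points are constants.\<close>
  also have "\<dots> = 2 * (\<Sum>t\<in>?Z. f X t * (m - f X t) + f Y t * (m - f Y t))
      - 2 * (\<Sum>t\<in>X. f X t * (m - f X t)) - 2 * (\<Sum>t\<in>Y. f Y t * (m - f Y t))"
    by (simp add: sum.distrib split)
  also have "(\<Sum>t\<in>X. f X t * (m - f X t)) = real m * ((real m)\<^sup>2 - 1) / 6"
    using sum_circular_products_below[OF assms(1) injX, of y] by (simp add: f_def assms)
  also have "(\<Sum>t\<in>Y. f Y t * (m - f Y t)) = real m * ((real m)\<^sup>2 - 1) / 6"
    using sum_circular_products_below[OF assms(2) injY, of y] by (simp add: f_def assms)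
  also have "(\<Sum>t\<in>?Z. f X t * (m - f X t) + f Y t * (m - f Y t))
      = (\<Sum>t\<in>?Z. f ?Z t * (2 * m - f ?Z t)) / 2 - (\<Sum>t\<in>?Z. real_of_int ((D t - D y)\<^sup>2)) / 2"
    unfolding pt by (simp add: sum_subtractf sum_divide_distrib)
  also have "(\<Sum>t\<in>?Z. f ?Z t * (2 * m - f ?Z t)) = 2 * real m * ((2 * real m)\<^sup>2 - 1) / 6"
    using sum_circular_products_below[OF fin injZ, of y] by (simp add: f_def cardZ)
  finally have main: "Phi q X X {y} Y + Phi q Y Y {y} X
      = (2 * real m ^ 3 + real m) / 3 - (\<Sum>t\<in>?Z. real_of_int ((D t - D y)\<^sup>2))"
    by (simp add: field_simps power2_eq_square power3_eq_cube)
  \<comment> \<open>A difference and a sum of two ranks have the same parity. The ranks in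
    \<open>?Z\<close> run through \<open>0, ..., 2 * m - 1\<close>, so exactly \<open>m\<close> of
    these terms are odd, whatever the rank of \<open>y\<close>.\<close>
  have "(\<Sum>t\<in>?Z. of_bool (odd (D t - D y))) = (\<Sum>t\<in>?Z. of_bool (odd (below q ?Z t + below q ?Z y)) :: real)"
    unfolding below_Z D_def by (intro sum.cong refl) auto
  also have "\<dots> = (\<Sum>r<2 * m. of_bool (odd (r + below q ?Z y)))"
    using sum_rank[OF fin injZ, of "\<lambda>r. of_bool (odd (r + below q ?Z y))"]
    by (simp only: cardZ below_def[of q ?Z t for t])
  also have "\<dots> = real m" by (rule sum_odd_diff)
  finally show ?thesis using main by (simp add: sum_subtractf field_simps)
qed

text \<open>The square of an integer is at least its parity.\<close>

lemma Phi_XXyY_plus_Phi_YYyX_le: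
  assumes "finite X" "finite Y" "X \<inter> Y = {}" "y \<notin> X" "y \<notin> Y" "inj_on q (insert y (X \<union> Y))"
    and "card X = m" "card Y = m"
  shows "Phi q X X {y} Y + Phi q Y Y {y} X \<le> 2 * (real m ^ 3 - real m) / 3"
proof -
  have "of_bool (odd z) \<le> real_of_int (z\<^sup>2)" for z :: int
  proof (cases "z = 0")
    case False
    then have "1 \<le> z\<^sup>2" by (smt (verit) power2_less_eq_zero_iff)
    then have "1 \<le> real_of_int (z\<^sup>2)" by linarith
    then show ?thesis by (simp add: of_bool_def)
  qed simp
  then have "0 \<le> (\<Sum>t\<in>X \<union> Y. real_of_int ((D t - D y)\<^sup>2) - of_bool (odd (D t - D y)))" for D :: "'a \<Rightarrow> int"
    by (intro sum_nonneg) (simp only: diff_ge_0_iff_ge)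
  then show ?thesis
    unfolding Phi_XXyY_plus_Phi_YYyX[OF assms] by (simp only: diff_le_eq le_add_same_cancel1)
qed

text \<open>Alternation of \<open>X\<close> and \<open>Y\<close>, starting with \<open>X\<close>,
  keeps the rank difference \<open>?D\<close> in \<open>{0, 1}\<close>. Differences of such values
  lie in \<open>{-1, 0, 1}\<close>, where the square equals the parity.\<close>

lemma Phi_XXyY_plus_Phi_YYyX_eq:
  assumes "finite X" "finite Y" "X \<inter> Y = {}" "y \<notin> X" "y \<notin> Y" "inj_on q (insert y (X \<union> Y))"
    and "card X = m" "card Y = m"
    and bal: "\<And>v. v \<in> insert y (X \<union> Y) \<Longrightarrow> below q Y v \<le> below q X v \<and> below q X v \<le> Suc (below q Y v)"
  shows "Phi q X X {y} Y + Phi q Y Y {y} X = 2 * (real m ^ 3 - real m) / 3"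
proof -
  let ?D = "\<lambda>v. int (below q X v) - int (below q Y v)"
  have "real_of_int ((?D t - ?D y)\<^sup>2) - of_bool (odd (?D t - ?D y)) = 0" if "t \<in> X \<union> Y" for t
  proof -
    have "?D v = 0 \<or> ?D v = 1" if "v \<in> insert y (X \<union> Y)" for v using bal[OF that] by linarith
    from this[of t] this[of y] that have "?D t = 0 \<or> ?D t = 1" "?D y = 0 \<or> ?D y = 1" by blast+
    then show ?thesis by (elim disjE) (simp_all only:, simp_all)
  qed
  then have "(\<Sum>t\<in>X \<union> Y. real_of_int ((?D t - ?D y)\<^sup>2) - of_bool (odd (?D t - ?D y))) = 0"
    by (rule sum.neutral[OF ballI])
  then show ?thesis
    unfolding Phi_XXyY_plus_Phi_YYyX[OF assms(1-8)] by (simp only: diff_zero)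
qed

section \<open>Tuples with at least three points in one class\<close>

lemma sum_distinct_triples:
  assumes "finite A"
  defines "a \<equiv> real (card A)"
  shows "(\<Sum>x\<in>A. \<Sum>y\<in>A. \<Sum>z\<in>A. of_bool (distinct [x, y, z])) = a * (a - 1) * (a - 2)"
proof -
  have 1: "(\<Sum>z\<in>A. of_bool (distinct [x, y, z])) = (a - 2) * of_bool (x \<noteq> y)"
    if "x \<in> A" "y \<in> A" for x y
  proof (cases "x = y")
    case False
    have "(\<Sum>z\<in>A. of_bool (distinct [x, y, z])) = (\<Sum>z\<in>A - {x, y}. 1::real)"
      using assms(1) False by (intro sum.mono_neutral_cong_right) auto
    moreover have "card A \<ge> 2"
      using False that assms(1) by (metis card_2_iff card_mono empty_subsetI insert_subset)
    ultimately show ?thesis using that assms(1) False by (simp add: a_def of_nat_diff)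
  qed simp
  have 2: "(\<Sum>y\<in>A. (a - 2) * of_bool (x \<noteq> y)) = (a - 1) * (a - 2)" if "x \<in> A" for x
  proof -
    have "(\<Sum>y\<in>A. (a - 2) * of_bool (x \<noteq> y)) = (\<Sum>y\<in>A - {x}. a - 2)"
      using assms(1) by (intro sum.mono_neutral_cong_right) auto
    moreover have "card A \<ge> 1" using that assms(1) by (metis One_nat_def Suc_leI card_gt_0_iff empty_iff)
    ultimately show ?thesis using that assms(1) by (simp add: a_def of_nat_diff)
  qed
  have "(\<Sum>x\<in>A. \<Sum>y\<in>A. \<Sum>z\<in>A. of_bool (distinct [x, y, z])) = (\<Sum>x\<in>A. (a - 1) * (a - 2))"
    by (rule sum.cong[OF refl], subst 2[symmetric], assumption, rule sum.cong[OF refl]) (rule 1)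
  then show ?thesis by (simp add: a_def)
qed

text \<open>Among three distinct points of \<open>A\<close>, exactly one is the partner of
  \<open>z\<close> in the crossing pair. The three choices give equal sums by renaming, so each is a
  third of all ordered distinct triples.\<close>

lemma sum_interlaced_point:
  assumes "finite A" "z \<notin> A" "inj_on q (insert z A)"
  defines "a \<equiv> real (card A)"
  shows "(\<Sum>x\<in>A. \<Sum>y\<in>A. \<Sum>t\<in>A. of_bool (interlaced (q x) (q y) (q t) (q z))) = a * (a - 1) * (a - 2) / 3"
    (is "?S = _")
proof -
  let ?i = "\<lambda>x y t. of_bool (interlaced (q x) (q y) (q t) (q z)) :: real"
  have three: "?i x y t + ?i x t y + ?i y t x = of_bool (distinct [x, y, t])"
    if "x \<in> A" "y \<in> A" "t \<in> A" for x y t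
  proof (cases "distinct [x, y, t]")
    case True
    then have "distinct [q x, q y, q t, q z]"
      using that assms(2,3) unfolding inj_on_def by auto
    from interlaced_three_pairings[OF this] True show ?thesis
      by (simp add: interlaced_swap_pairs[of "q x" "q z"])
  next
    case False
    then have "\<not> interlaced (q x) (q y) (q t) (q z)" "\<not> interlaced (q x) (q t) (q y) (q z)"
      "\<not> interlaced (q y) (q t) (q x) (q z)"
      using interlaced_distinct by fastforce+
    then show ?thesis using False by simp
  qed
  have "(\<Sum>x\<in>A. \<Sum>y\<in>A. \<Sum>t\<in>A. ?i x t y) = ?S"
    by (rule sum.cong[OF refl]) (rule sum.swap)
  moreover have "(\<Sum>x\<in>A. \<Sum>y\<in>A. \<Sum>t\<in>A. ?i y t x) = ?S"
  proof -
    have "(\<Sum>x\<in>A. \<Sum>y\<in>A. \<Sum>t\<in>A. ?i y t x) = (\<Sum>y\<in>A. \<Sum>x\<in>A. \<Sum>t\<in>A. ?i y t x)"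
      by (rule sum.swap)
    also have "\<dots> = (\<Sum>y\<in>A. \<Sum>t\<in>A. \<Sum>x\<in>A. ?i y t x)"
      by (rule sum.cong[OF refl]) (rule sum.swap)
    finally show ?thesis .
  qed
  ultimately have "3 * ?S = (\<Sum>x\<in>A. \<Sum>y\<in>A. \<Sum>t\<in>A. ?i x y t + ?i x t y + ?i y t x)"
    by (simp only: sum.distrib)
  also have "\<dots> = (\<Sum>x\<in>A. \<Sum>y\<in>A. \<Sum>t\<in>A. of_bool (distinct [x, y, t]))"
    by (intro sum.cong refl) (rule three)
  also have "\<dots> = a * (a - 1) * (a - 2)"
    unfolding a_def by (rule sum_distinct_triples[OF assms(1)])
  finally show ?thesis by simp
qed

lemma Phi_move_last:
  "Phi q A B C D = (\<Sum>d\<in>D. \<Sum>a\<in>A. \<Sum>b\<in>B. \<Sum>c\<in>C. of_bool (interlaced (q a) (q b) (q c) (q d)))"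
proof -
  have "Phi q A B C D = (\<Sum>a\<in>A. \<Sum>b\<in>B. \<Sum>d\<in>D. \<Sum>c\<in>C. of_bool (interlaced (q a) (q b) (q c) (q d)))"
    unfolding Phi_def by (rule sum.cong[OF refl], rule sum.cong[OF refl], rule sum.swap)
  also have "\<dots> = (\<Sum>a\<in>A. \<Sum>d\<in>D. \<Sum>b\<in>B. \<Sum>c\<in>C. of_bool (interlaced (q a) (q b) (q c) (q d)))"
    by (rule sum.cong[OF refl]) (rule sum.swap)
  also have "\<dots> = (\<Sum>d\<in>D. \<Sum>a\<in>A. \<Sum>b\<in>B. \<Sum>c\<in>C. of_bool (interlaced (q a) (q b) (q c) (q d)))"
    by (rule sum.swap)
  finally show ?thesis .
qed

text \<open>Every \<open>d\<close> contributes the same number, so these quadruples are insensitive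
  to the arrangement.\<close>

lemma Phi_XXXD:
  assumes "finite X" "X \<inter> D = {}" "inj_on q (X \<union> D)"
  defines "a \<equiv> real (card X)"
  shows "Phi q X X X D = a * (a - 1) * (a - 2) * real (card D) / 3"
proof -
  have "Phi q X X X D = (\<Sum>d\<in>D. a * (a - 1) * (a - 2) / 3)"
    unfolding Phi_move_last a_def
    by (intro sum.cong refl sum_interlaced_point) (use assms in \<open>auto simp: inj_on_def\<close>)
  then show ?thesis by simp
qed

text \<open>Interlaced points are distinct, so the last point \<open>d\<close> can be removed from
  the ranges of the other three; what remains is the count for a point outside
  \<open>X - {d}\<close>. The value is eight times the binomial coefficient of \<open>a\<close> over
  4.\<close>

lemma Phi_XXXX:
  assumes "finite X" "inj_on q X"
  defines "a \<equiv> real (card X)"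
  shows "Phi q X X X X = a * (a - 1) * (a - 2) * (a - 3) / 3"
proof -
  have "(\<Sum>x\<in>X. \<Sum>y\<in>X. \<Sum>t\<in>X. of_bool (interlaced (q x) (q y) (q t) (q d)))
    = (a - 1) * (a - 2) * (a - 3) / 3" if "d \<in> X" for d
  proof -
    let ?i = "\<lambda>x y t. of_bool (interlaced (q x) (q y) (q t) (q d)) :: real"
    have z: "?i d y t = 0" "?i x d t = 0" "?i x y d = 0" for x y t
      using interlaced_distinct by fastforce+
    have "(\<Sum>x\<in>X. \<Sum>y\<in>X. \<Sum>t\<in>X. ?i x y t) = (\<Sum>x\<in>X - {d}. \<Sum>y\<in>X - {d}. \<Sum>t\<in>X - {d}. ?i x y t)"
      by (simp add: sum.remove[OF assms(1) that] z del: sum_of_bool_eq)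
    also have "\<dots> = (a - 1) * (a - 2) * (a - 3) / 3"
    proof -
      have "card X \<ge> 1" using that assms(1) by (metis One_nat_def Suc_leI card_gt_0_iff empty_iff)
      then have "real (card (X - {d})) = a - 1" using that assms(1) by (simp add: a_def of_nat_diff)
      then show ?thesis
        using sum_interlaced_point[of "X - {d}" d q] assms that by (simp add: insert_absorb)
    qed
    finally show ?thesis .
  qed
  then have "Phi q X X X X = (\<Sum>d\<in>X. (a - 1) * (a - 2) * (a - 3) / 3)"
    unfolding Phi_move_last by (rule sum.cong[OF refl])
  then show ?thesis by (simp add: a_def)
qed

lemma Phi_swap_right: "Phi q A B C D = Phi q A B D C"
proof -
  have "(\<Sum>c\<in>C. \<Sum>d\<in>D. of_bool (interlaced (q a) (q b) (q c) (q d)))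
    = (\<Sum>d\<in>D. \<Sum>c\<in>C. of_bool (interlaced (q a) (q b) (q d) (q c)) :: real)" for a b
    by (subst sum.swap) (simp only: interlaced_swap_right)
  then show ?thesis unfolding Phi_def by (simp only:)
qed

lemma Phi_swap_pairs: "Phi q A B C D = Phi q C D A B"
proof -
  have "Phi q A B C D = (\<Sum>d\<in>D. \<Sum>c\<in>C. \<Sum>a\<in>A. \<Sum>b\<in>B. of_bool (interlaced (q a) (q b) (q c) (q d)))"
    unfolding Phi_move_last
  proof (rule sum.cong[OF refl])
    fix d
    have "(\<Sum>a\<in>A. \<Sum>b\<in>B. \<Sum>c\<in>C. of_bool (interlaced (q a) (q b) (q c) (q d)))
      = (\<Sum>a\<in>A. \<Sum>c\<in>C. \<Sum>b\<in>B. of_bool (interlaced (q a) (q b) (q c) (q d)) :: real)"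
      by (rule sum.cong[OF refl]) (rule sum.swap)
    also have "\<dots> = (\<Sum>c\<in>C. \<Sum>a\<in>A. \<Sum>b\<in>B. of_bool (interlaced (q a) (q b) (q c) (q d)))"
      by (rule sum.swap)
    finally show "(\<Sum>a\<in>A. \<Sum>b\<in>B. \<Sum>c\<in>C. of_bool (interlaced (q a) (q b) (q c) (q d)))
      = (\<Sum>c\<in>C. \<Sum>a\<in>A. \<Sum>b\<in>B. of_bool (interlaced (q a) (q b) (q c) (q d)) :: real)" .
  qed
  also have "\<dots> = (\<Sum>c\<in>C. \<Sum>d\<in>D. \<Sum>a\<in>A. \<Sum>b\<in>B. of_bool (interlaced (q a) (q b) (q c) (q d)))"
    by (rule sum.swap)
  also have "\<dots> = Phi q C D A B"
    unfolding Phi_def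
    by (intro sum.cong refl) (simp only: interlaced_swap_pairs[of "q _" "q _" "q c" "q d" for c d])
  finally show ?thesis .
qed

lemma Phi_UN_last:
  assumes "finite I" "\<And>i. i \<in> I \<Longrightarrow> finite (K i)" "\<And>i j. i \<in> I \<Longrightarrow> j \<in> I \<Longrightarrow> i \<noteq> j \<Longrightarrow> K i \<inter> K j = {}"
  shows "Phi q A B C (\<Union>i\<in>I. K i) = (\<Sum>i\<in>I. Phi q A B C (K i))"
  unfolding Phi_move_last by (rule sum.UNION_disjoint) (use assms in auto)

lemma Phi_UN_third:
  assumes "finite I" "\<And>i. i \<in> I \<Longrightarrow> finite (K i)" "\<And>i j. i \<in> I \<Longrightarrow> j \<in> I \<Longrightarrow> i \<noteq> j \<Longrightarrow> K i \<inter> K j = {}"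
  shows "Phi q A B (\<Union>i\<in>I. K i) D = (\<Sum>i\<in>I. Phi q A B (K i) D)"
  unfolding Phi_swap_right[of q A B _ D] by (rule Phi_UN_last) (use assms in auto)

section \<open>Sums over pairs and triples of parts\<close>

lemma sum_off_diagonal_swap:
  fixes H :: "'i \<Rightarrow> 'i \<Rightarrow> real"
  assumes "finite J"
  shows "(\<Sum>i\<in>J. \<Sum>j\<in>J - {i}. H i j) = (\<Sum>j\<in>J. \<Sum>i\<in>J - {j}. H i j)"
proof -
  have e: "(\<Sum>j\<in>J - {i}. g j) = (\<Sum>j\<in>J. of_bool (j \<noteq> i) * g j)" for g :: "'i \<Rightarrow> real" and i
    using assms by (intro sum.mono_neutral_cong_left) auto
  have "(\<Sum>i\<in>J. \<Sum>j\<in>J - {i}. H i j) = (\<Sum>i\<in>J. \<Sum>j\<in>J. of_bool (j \<noteq> i) * H i j)"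
    unfolding e ..
  also have "\<dots> = (\<Sum>j\<in>J. \<Sum>i\<in>J. of_bool (j \<noteq> i) * H i j)" by (rule sum.swap)
  also have "\<dots> = (\<Sum>j\<in>J. \<Sum>i\<in>J - {j}. H i j)" unfolding e by (simp only: eq_commute)
  finally show ?thesis .
qed

lemma sum_off_diagonal_symmetrize:
  fixes H :: "'i \<Rightarrow> 'i \<Rightarrow> real"
  assumes "finite J"
  shows "2 * (\<Sum>i\<in>J. \<Sum>j\<in>J - {i}. H i j) = (\<Sum>i\<in>J. \<Sum>j\<in>J - {i}. H i j + H j i)"
  using sum_off_diagonal_swap[OF assms, of H] by (simp add: sum.distrib)

text \<open>Only the joint contribution of the two orders of a pair is controlled, so the sum is
  doubled and symmetrized before it is estimated.\<close>

lemma sum_off_diagonal_le: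
  fixes H :: "'i \<Rightarrow> 'i \<Rightarrow> real"
  assumes "finite J" "\<And>i j. i \<in> J \<Longrightarrow> j \<in> J \<Longrightarrow> i \<noteq> j \<Longrightarrow> H i j + H j i \<le> c"
  shows "(\<Sum>i\<in>J. \<Sum>j\<in>J - {i}. H i j) \<le> real (card J) * (real (card J) - 1) * c / 2"
proof -
  have "(\<Sum>j\<in>J - {i}. H i j + H j i) \<le> (real (card J) - 1) * c" if "i \<in> J" for i
  proof -
    have "(\<Sum>j\<in>J - {i}. H i j + H j i) \<le> (\<Sum>j\<in>J - {i}. c)"
      using assms(2) that by (intro sum_mono) auto
    moreover have "card J \<ge> 1" using that assms(1) by (metis One_nat_def Suc_leI card_gt_0_iff empty_iff)
    ultimately show ?thesis using that assms(1) by (simp add: of_nat_diff)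
  qed
  then have "(\<Sum>i\<in>J. \<Sum>j\<in>J - {i}. H i j + H j i) \<le> (\<Sum>i\<in>J. (real (card J) - 1) * c)"
    by (rule sum_mono)
  then show ?thesis using sum_off_diagonal_symmetrize[OF assms(1), of H] by simp
qed

text \<open>The upper bound, applied to \<open>H\<close> and to \<open>- H\<close>.\<close>

lemma sum_off_diagonal_eq:
  fixes H :: "'i \<Rightarrow> 'i \<Rightarrow> real"
  assumes "finite J" "\<And>i j. i \<in> J \<Longrightarrow> j \<in> J \<Longrightarrow> i \<noteq> j \<Longrightarrow> H i j + H j i = c"
  shows "(\<Sum>i\<in>J. \<Sum>j\<in>J - {i}. H i j) = real (card J) * (real (card J) - 1) * c / 2"
proof (rule antisym)
  show "(\<Sum>i\<in>J. \<Sum>j\<in>J - {i}. H i j) \<le> real (card J) * (real (card J) - 1) * c / 2"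
    using assms by (intro sum_off_diagonal_le) auto
  have "(\<Sum>i\<in>J. \<Sum>j\<in>J - {i}. - H i j) \<le> real (card J) * (real (card J) - 1) * (- c) / 2"
  proof (rule sum_off_diagonal_le[OF assms(1)])
    fix i j assume "i \<in> J" "j \<in> J" "i \<noteq> j"
    from assms(2)[OF this] show "- H i j + - H j i \<le> - c" by linarith
  qed
  then show "real (card J) * (real (card J) - 1) * c / 2 \<le> (\<Sum>i\<in>J. \<Sum>j\<in>J - {i}. H i j)"
    by (simp add: sum_negf)
qed


text \<open>Here \<open>G i j k\<close> stands for tuples whose first pair lies in part
  \<open>i\<close> and whose other two points lie in \<open>j\<close> and \<open>k\<close>. The left
  side is inclusion-exclusion: either pair may be monochromatic, and tuples with both are counted
  twice. Sorting by coincidences among the indices gives the weights: \<open>G i i j\<close> occurs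
  in two index orders and is doubled, hence 4; \<open>G i j j\<close> has 2 - 1 = 1. The terms
  \<open>G 0 j j\<close> and \<open>G j 0 0\<close> are equal by \<open>pair\<close> and together
  make the diagonal of \<open>2 * G 0 j k\<close>. The bracket collects what depends on the
  arrangement.\<close>

lemma noncrossing_sum_split:
  fixes G :: "nat \<Rightarrow> nat \<Rightarrow> nat \<Rightarrow> real" and n :: nat
  assumes sym: "\<And>i j k. G i j k = G i k j" and pair: "\<And>i j. G i j j = G j i i"
  defines "J \<equiv> {1..n}"
  shows "2 * (\<Sum>i\<le>n. \<Sum>j\<le>n. \<Sum>k\<le>n. G i j k) - (\<Sum>i\<le>n. \<Sum>j\<le>n. G i j j)
    = G 0 0 0 + 4 * (\<Sum>j\<in>J. G 0 0 j) + 4 * (\<Sum>i\<in>J. G i i 0) + (\<Sum>i\<in>J. G i i i)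
      + 4 * (\<Sum>i\<in>J. \<Sum>j\<in>J - {i}. G i i j)
      + (2 * (\<Sum>j\<in>J. \<Sum>k\<in>J. G 0 j k) + (\<Sum>i\<in>J. \<Sum>j\<in>J - {i}. G i j j)
      + 4 * (\<Sum>i\<in>J. \<Sum>j\<in>J - {i}. G i 0 j)
      + 2 * (\<Sum>k\<in>J. \<Sum>i\<in>J - {k}. \<Sum>j\<in>J - {k} - {i}. G i k j))"
proof -
  have fin: "finite J" by (simp add: J_def)
  have zero: "(\<Sum>i\<le>n. g i) = g 0 + (\<Sum>i\<in>J. g i)" for g :: "nat \<Rightarrow> real"
  proof -
    have "{..n} = insert 0 J" by (auto simp: J_def)
    then show ?thesis by (simp add: J_def)
  qed
  have diag: "(\<Sum>j\<in>J. g j) = g i + (\<Sum>j\<in>J - {i}. g j)" if "i \<in> J" for g :: "nat \<Rightarrow> real" and i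
    by (rule sum.remove[OF fin that])
  have 1: "(\<Sum>i\<in>J. \<Sum>j\<in>J. G i 0 j) = (\<Sum>i\<in>J. G i i 0) + (\<Sum>i\<in>J. \<Sum>j\<in>J - {i}. G i 0 j)"
  proof -
    have "(\<Sum>i\<in>J. \<Sum>j\<in>J. G i 0 j) = (\<Sum>i\<in>J. G i 0 i + (\<Sum>j\<in>J - {i}. G i 0 j))"
      by (rule sum.cong[OF refl]) (rule diag)
    then show ?thesis by (simp add: sum.distrib sym[of _ 0])
  qed
  have 2: "(\<Sum>i\<in>J. \<Sum>j\<in>J. G i j j) = (\<Sum>i\<in>J. G i i i) + (\<Sum>i\<in>J. \<Sum>j\<in>J - {i}. G i j j)"
  proof -
    have "(\<Sum>i\<in>J. \<Sum>j\<in>J. G i j j) = (\<Sum>i\<in>J. G i i i + (\<Sum>j\<in>J - {i}. G i j j))"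
      by (rule sum.cong[OF refl]) (rule diag)
    then show ?thesis by (simp add: sum.distrib)
  qed
  have 3: "(\<Sum>i\<in>J. \<Sum>j\<in>J. \<Sum>k\<in>J. G i j k) = (\<Sum>i\<in>J. G i i i)
      + 2 * (\<Sum>i\<in>J. \<Sum>j\<in>J - {i}. G i i j) + (\<Sum>i\<in>J. \<Sum>j\<in>J - {i}. G i j j)
      + (\<Sum>k\<in>J. \<Sum>i\<in>J - {k}. \<Sum>j\<in>J - {k} - {i}. G i k j)"
  proof -
    have row: "(\<Sum>j\<in>J. \<Sum>k\<in>J. G i j k) = G i i i + 2 * (\<Sum>j\<in>J - {i}. G i i j)
      + (\<Sum>j\<in>J - {i}. G i j j) + (\<Sum>j\<in>J - {i}. \<Sum>k\<in>J - {j} - {i}. G i j k)" if i: "i \<in> J" for i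
    proof -
      have "(\<Sum>k\<in>J. G i j k) = G i i j + G i j j + (\<Sum>k\<in>J - {j} - {i}. G i j k)"
        if "j \<in> J - {i}" for j
      proof -
        have "(\<Sum>k\<in>J. G i j k) = G i j j + (\<Sum>k\<in>J - {j}. G i j k)" using that by (intro diag) simp
        also have "(\<Sum>k\<in>J - {j}. G i j k) = G i j i + (\<Sum>k\<in>J - {j} - {i}. G i j k)"
          using that i fin by (intro sum.remove) auto
        finally show ?thesis by (simp add: sym[of i j i])
      qed
      then have "(\<Sum>j\<in>J - {i}. \<Sum>k\<in>J. G i j k)
        = (\<Sum>j\<in>J - {i}. G i i j + G i j j + (\<Sum>k\<in>J - {j} - {i}. G i j k))"
        by (rule sum.cong[OF refl])
      moreover have "(\<Sum>k\<in>J. G i i k) = G i i i + (\<Sum>k\<in>J - {i}. G i i k)" by (rule diag[OF i])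
      ultimately show ?thesis using diag[OF i, of "\<lambda>j. \<Sum>k\<in>J. G i j k"]
        by (simp add: sum.distrib)
    qed
    have "(\<Sum>i\<in>J. \<Sum>j\<in>J. \<Sum>k\<in>J. G i j k) = (\<Sum>i\<in>J. G i i i + 2 * (\<Sum>j\<in>J - {i}. G i i j)
      + (\<Sum>j\<in>J - {i}. G i j j) + (\<Sum>j\<in>J - {i}. \<Sum>k\<in>J - {j} - {i}. G i j k))"
      by (rule sum.cong[OF refl]) (rule row)
    then show ?thesis
      using sum_off_diagonal_swap[OF fin, of "\<lambda>i j. \<Sum>k\<in>J - {j} - {i}. G i j k"]
      by (simp add: sum.distrib sum_distrib_left)
  qed
  have "(\<Sum>i\<le>n. \<Sum>j\<le>n. \<Sum>k\<le>n. G i j k) = G 0 0 0 + 2 * (\<Sum>j\<in>J. G 0 0 j) + (\<Sum>j\<in>J. \<Sum>k\<in>J. G 0 j k)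
      + (\<Sum>i\<in>J. G i 0 0) + 2 * (\<Sum>i\<in>J. \<Sum>j\<in>J. G i 0 j) + (\<Sum>i\<in>J. \<Sum>j\<in>J. \<Sum>k\<in>J. G i j k)"
  proof -
    have "(\<Sum>j\<in>J. G i j 0) = (\<Sum>j\<in>J. G i 0 j)" for i
      by (rule sum.cong[OF refl]) (rule sym)
    then show ?thesis by (simp add: zero sum.distrib sum_distrib_left)
  qed
  moreover have "(\<Sum>i\<le>n. \<Sum>j\<le>n. G i j j)
     = G 0 0 0 + 2 * (\<Sum>i\<in>J. G i 0 0) + (\<Sum>i\<in>J. \<Sum>j\<in>J. G i j j)"
  proof -
    have "(\<Sum>j\<in>J. G 0 j j) = (\<Sum>i\<in>J. G i 0 0)"
      by (rule sum.cong[OF refl]) (rule pair)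
    then show ?thesis by (simp add: zero sum.distrib)
  qed
  ultimately show ?thesis unfolding 1 2 3 by simp
qed


section \<open>Counting quadruples in a coloured arrangement\<close>

text \<open>The common setting of the two bounds: \<open>q\<close> is instantiated by the angles of
  an arbitrary drawing and by those of the optimal one. Colours are parts, with 0 the part of size
  \<open>p\<close>, and \<open>k\<close> is the share of part 0 in each of the \<open>m * n\<close>
  gaps between the other vertices.\<close>

locale colored_arrangement =
  fixes q :: "'a \<Rightarrow> real" and V :: "'a set" and c :: "'a \<Rightarrow> nat" and m n p k :: nat
  assumes finite_V: "finite V" and inj_V: "inj_on q V"
    and color_le: "v \<in> V \<Longrightarrow> c v \<le> n"
    and card_color_0: "card {v\<in>V. c v = 0} = p"
    and card_color: "1 \<le> i \<Longrightarrow> i \<le> n \<Longrightarrow> card {v\<in>V. c v = i} = m"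
    and p_eq: "p = k * (m * n)"
begin

definition K :: "nat \<Rightarrow> 'a set" where "K i = {v\<in>V. c v = i}"

abbreviation J :: "nat set" where "J \<equiv> {1..n}"

definition B :: "'a set" where "B = (\<Union>i\<in>J. K i)"

definition G :: "nat \<Rightarrow> nat \<Rightarrow> nat \<Rightarrow> real" where "G i j l = Phi q (K i) (K i) (K j) (K l)"

text \<open>
  The part of the count of monochromatic diagonals that depends on the arrangement; as
  \<open>Phi\<close> counts ordered tuples, each quadruple is counted eight times.
\<close>

definition noncrossing :: real where
  "noncrossing = 2 * Phi q (K 0) (K 0) B B + (\<Sum>i\<in>J. \<Sum>j\<in>J - {i}. G i j j)
      + 4 * (\<Sum>i\<in>J. \<Sum>j\<in>J - {i}. G i 0 j)
      + 2 * (\<Sum>l\<in>J. \<Sum>i\<in>J - {l}. \<Sum>j\<in>J - {l} - {i}. G i l j)"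

text \<open>Eight times the number of crossings: two orders inside each edge and two orders of the
  edges.\<close>

definition crossing_tuples :: real where
  "crossing_tuples = (\<Sum>x\<in>V. \<Sum>y\<in>V. \<Sum>z\<in>V. \<Sum>t\<in>V.
      of_bool (interlaced (q x) (q y) (q z) (q t) \<and> c x \<noteq> c y \<and> c z \<noteq> c t))"

lemma finite_K: "finite (K i)"
  by (simp add: K_def finite_V)

lemma K_subset: "K i \<subseteq> V"
  by (auto simp: K_def)

lemma K_disjoint: "i \<noteq> j \<Longrightarrow> K i \<inter> K j = {}"
  by (auto simp: K_def)

lemma V_eq_UN: "V = (\<Union>i\<in>{..n}. K i)"
  using color_le by (auto simp: K_def)

lemma card_K_0: "card (K 0) = p"
  using card_color_0 by (simp add: K_def)

lemma card_K: "i \<in> J \<Longrightarrow> card (K i) = m"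
  using card_color by (simp add: K_def)

lemma finite_B: "finite B"
  by (simp add: B_def finite_K)

lemma card_B: "card B = m * n"
proof -
  have "card B = (\<Sum>i\<in>J. card (K i))"
    unfolding B_def by (rule card_UN_disjoint) (auto simp: finite_V K_def)
  then show ?thesis by (simp add: card_K)
qed

lemma K_0_B: "K 0 \<inter> B = {}" "V = K 0 \<union> B"
proof -
  show "K 0 \<inter> B = {}" by (auto simp: B_def K_def)
  have "{..n} = insert 0 J" by auto
  then show "V = K 0 \<union> B" by (subst V_eq_UN) (simp add: B_def)
qed

lemma card_V: "card V = m * n + p"
  using K_0_B finite_B finite_K[of 0] card_B card_K_0 
  by (metis card_Un_disjoint add.commute)

lemma inj_sub: "S \<subseteq> V \<Longrightarrow> inj_on q S"
  using inj_V by (rule inj_on_subset)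

lemma sum_same_color:
  fixes g :: "'a \<Rightarrow> 'a \<Rightarrow> real"
  shows "(\<Sum>x\<in>V. \<Sum>y\<in>V. of_bool (c x = c y) * g x y) = (\<Sum>i\<le>n. \<Sum>x\<in>K i. \<Sum>y\<in>K i. g x y)"
proof -
  have "(\<Sum>x\<in>V. \<Sum>y\<in>V. of_bool (c x = c y) * g x y)
    = (\<Sum>i\<le>n. \<Sum>x\<in>K i. \<Sum>y\<in>V. of_bool (c x = c y) * g x y)"
  proof -
    have "(\<Sum>i\<le>n. \<Sum>x\<in>K i. h x) = (\<Sum>x\<in>(\<Union>i\<in>{..n}. K i). h x)" for h :: "'a \<Rightarrow> real"
      by (rule sum.UNION_disjoint[symmetric]) (auto simp: finite_V K_def)
    then show ?thesis by (simp only: V_eq_UN[symmetric])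
  qed
  also have "\<dots> = (\<Sum>i\<le>n. \<Sum>x\<in>K i. \<Sum>y\<in>K i. g x y)"
  proof (rule sum.cong[OF refl], rule sum.cong[OF refl])
    fix i x assume "x \<in> K i"
    then show "(\<Sum>y\<in>V. of_bool (c x = c y) * g x y) = (\<Sum>y\<in>K i. g x y)"
      by (intro sum.mono_neutral_cong_right) (auto simp: K_def finite_V)
  qed
  finally show ?thesis .
qed

lemma Phi_V_V: "Phi q A A V V = (\<Sum>j\<le>n. \<Sum>l\<le>n. Phi q A A (K j) (K l))"
  by (subst (1 2) V_eq_UN, subst Phi_UN_third)
    (auto simp: Phi_UN_last finite_K K_disjoint)

text \<open>Inclusion-exclusion over the events \<open>c x = c y\<close> and
  \<open>c z = c t\<close>; exchanging the two pairs shows that both events have the same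
  count.\<close>

lemma crossing_tuples_eq:
  "crossing_tuples = Phi q V V V V
    - (2 * (\<Sum>i\<le>n. \<Sum>j\<le>n. \<Sum>l\<le>n. G i j l) - (\<Sum>i\<le>n. \<Sum>j\<le>n. G i j j))"
proof -
  let ?S = "\<lambda>x y z t. of_bool (interlaced (q x) (q y) (q z) (q t)) :: real"
  have left: "(\<Sum>x\<in>V. \<Sum>y\<in>V. of_bool (c x = c y) * (\<Sum>z\<in>V. \<Sum>t\<in>V. ?S x y z t))
      = (\<Sum>i\<le>n. \<Sum>j\<le>n. \<Sum>l\<le>n. G i j l)"
    unfolding sum_same_color G_def Phi_V_V[symmetric] by (simp only: Phi_def)
  have right: "(\<Sum>x\<in>V. \<Sum>y\<in>V. \<Sum>z\<in>V. \<Sum>t\<in>V. of_bool (c z = c t) * ?S x y z t)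
      = (\<Sum>i\<le>n. \<Sum>j\<le>n. \<Sum>l\<le>n. G i j l)"
  proof -
    have "(\<Sum>x\<in>V. \<Sum>y\<in>V. \<Sum>z\<in>V. \<Sum>t\<in>V. of_bool (c z = c t) * ?S x y z t)
      = (\<Sum>x\<in>V. \<Sum>y\<in>V. \<Sum>i\<le>n. \<Sum>z\<in>K i. \<Sum>t\<in>K i. ?S x y z t)"
      unfolding sum_same_color ..
    also have "\<dots> = (\<Sum>x\<in>V. \<Sum>i\<le>n. \<Sum>y\<in>V. \<Sum>z\<in>K i. \<Sum>t\<in>K i. ?S x y z t)"
      by (rule sum.cong[OF refl]) (rule sum.swap)
    also have "\<dots> = (\<Sum>i\<le>n. \<Sum>x\<in>V. \<Sum>y\<in>V. \<Sum>z\<in>K i. \<Sum>t\<in>K i. ?S x y z t)"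
      by (rule sum.swap)
    also have "\<dots> = (\<Sum>i\<le>n. Phi q (K i) (K i) V V)"
      by (rule sum.cong[OF refl], subst Phi_swap_pairs) (simp only: Phi_def)
    finally show ?thesis by (simp only: G_def Phi_V_V)
  qed
  have both: "(\<Sum>x\<in>V. \<Sum>y\<in>V. of_bool (c x = c y) * (\<Sum>z\<in>V. \<Sum>t\<in>V. of_bool (c z = c t) * ?S x y z t))
      = (\<Sum>i\<le>n. \<Sum>j\<le>n. G i j j)"
  proof -
    have "(\<Sum>x\<in>A. \<Sum>y\<in>A. \<Sum>j\<le>n. \<Sum>z\<in>K j. \<Sum>t\<in>K j. ?S x y z t)
      = (\<Sum>j\<le>n. Phi q A A (K j) (K j))" for A
    proof -
      have "(\<Sum>x\<in>A. \<Sum>y\<in>A. \<Sum>j\<le>n. \<Sum>z\<in>K j. \<Sum>t\<in>K j. ?S x y z t)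
        = (\<Sum>x\<in>A. \<Sum>j\<le>n. \<Sum>y\<in>A. \<Sum>z\<in>K j. \<Sum>t\<in>K j. ?S x y z t)"
        by (rule sum.cong[OF refl]) (rule sum.swap)
      also have "\<dots> = (\<Sum>j\<le>n. \<Sum>x\<in>A. \<Sum>y\<in>A. \<Sum>z\<in>K j. \<Sum>t\<in>K j. ?S x y z t)"
        by (rule sum.swap)
      finally show ?thesis by (simp only: Phi_def)
    qed
    then show ?thesis unfolding sum_same_color G_def by (intro sum.cong refl)
  qed
  have "crossing_tuples = (\<Sum>x\<in>V. \<Sum>y\<in>V. \<Sum>z\<in>V. \<Sum>t\<in>V. ?S x y z t - of_bool (c x = c y) * ?S x y z t
      - of_bool (c z = c t) * ?S x y z t + of_bool (c x = c y) * (of_bool (c z = c t) * ?S x y z t))"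
    unfolding crossing_tuples_def by (intro sum.cong refl) auto
  also have "\<dots> = (\<Sum>x\<in>V. \<Sum>y\<in>V. \<Sum>z\<in>V. \<Sum>t\<in>V. ?S x y z t)
      - (\<Sum>x\<in>V. \<Sum>y\<in>V. of_bool (c x = c y) * (\<Sum>z\<in>V. \<Sum>t\<in>V. ?S x y z t))
      - (\<Sum>x\<in>V. \<Sum>y\<in>V. \<Sum>z\<in>V. \<Sum>t\<in>V. of_bool (c z = c t) * ?S x y z t)
      + (\<Sum>x\<in>V. \<Sum>y\<in>V. of_bool (c x = c y) * (\<Sum>z\<in>V. \<Sum>t\<in>V. of_bool (c z = c t) * ?S x y z t))"
    by (simp only: sum.distrib sum_subtractf sum_distrib_left)
  also have "(\<Sum>x\<in>V. \<Sum>y\<in>V. \<Sum>z\<in>V. \<Sum>t\<in>V. ?S x y z t) = Phi q V V V V"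
    by (simp only: Phi_def)
  finally show ?thesis unfolding left right both by simp
qed

text \<open>All tuples outside \<open>noncrossing\<close> have three or four points in one part, or
  are counted in \<open>Phi q V V V V\<close>, where each quadruple has exactly one crossing pair.
  These counts depend on the part sizes alone.\<close>

lemma crossing_tuples_value:
  fixes M P N :: real
  defines "M \<equiv> real m" and "P \<equiv> real p" and "N \<equiv> real n"
  shows "crossing_tuples + noncrossing
    = (M * N + P) * (M * N + P - 1) * (M * N + P - 2) * (M * N + P - 3) / 3
      - P * (P - 1) * (P - 2) * (P - 3) / 3 - 4 * N * P * (P - 1) * (P - 2) * M / 3
      - 4 * N * M * (M - 1) * (M - 2) * P / 3 - N * M * (M - 1) * (M - 2) * (M - 3) / 3
      - 4 * N * (N - 1) * M * (M - 1) * (M - 2) * M / 3"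
proof -
  have GV: "Phi q V V V V = (M * N + P) * (M * N + P - 1) * (M * N + P - 2) * (M * N + P - 3) / 3"
    using Phi_XXXX[OF finite_V inj_V] by (simp add: card_V M_def N_def P_def)
  have Gii: "G i i i = real (card (K i)) * (real (card (K i)) - 1) * (real (card (K i)) - 2) * (real (card (K i)) - 3) / 3" for i
    unfolding G_def by (rule Phi_XXXX[OF finite_K inj_sub[OF K_subset]])
  have Gij: "G i i j = real (card (K i)) * (real (card (K i)) - 1) * (real (card (K i)) - 2) * real (card (K j)) / 3"
    if "i \<noteq> j" for i j
    unfolding G_def using K_subset that
    by (intro Phi_XXXD finite_K K_disjoint inj_sub) auto
  have s1: "(\<Sum>j\<in>J. G 0 0 j) = N * P * (P - 1) * (P - 2) * M / 3"
  proof -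
    have "(\<Sum>j\<in>J. G 0 0 j) = (\<Sum>j\<in>J. P * (P - 1) * (P - 2) * M / 3)"
      by (intro sum.cong refl, subst Gij) (auto simp: card_K card_K_0 P_def M_def)
    then show ?thesis by (simp add: N_def)
  qed
  have s2: "(\<Sum>i\<in>J. G i i 0) = N * M * (M - 1) * (M - 2) * P / 3"
  proof -
    have "(\<Sum>i\<in>J. G i i 0) = (\<Sum>j\<in>J. M * (M - 1) * (M - 2) * P / 3)"
      by (intro sum.cong refl, subst Gij) (auto simp: card_K card_K_0 P_def M_def)
    then show ?thesis by (simp add: N_def)
  qed
  have s3: "(\<Sum>i\<in>J. G i i i) = N * M * (M - 1) * (M - 2) * (M - 3) / 3"
  proof -
    have "(\<Sum>i\<in>J. G i i i) = (\<Sum>j\<in>J. M * (M - 1) * (M - 2) * (M - 3) / 3)"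
      by (intro sum.cong refl) (simp add: Gii card_K M_def)
    then show ?thesis by (simp add: N_def)
  qed
  have s4: "(\<Sum>i\<in>J. \<Sum>j\<in>J - {i}. G i i j) = N * (N - 1) * (M * (M - 1) * (M - 2) * M) / 3"
  proof -
    have "(\<Sum>i\<in>J. \<Sum>j\<in>J - {i}. G i i j)
      = real (card J) * (real (card J) - 1) * (2 * M * (M - 1) * (M - 2) * M / 3) / 2"
    proof (rule sum_off_diagonal_eq)
      fix i j assume ij: "i \<in> J" "j \<in> J" "i \<noteq> j"
      show "G i i j + G j j i = 2 * M * (M - 1) * (M - 2) * M / 3"
        using ij Gij[of i j] Gij[of j i] card_K[OF ij(1)] card_K[OF ij(2)] by (simp add: M_def)
    qed simp
    then show ?thesis by (simp add: N_def)
  qed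
  have s5: "(\<Sum>j\<in>J. \<Sum>l\<in>J. G 0 j l) = Phi q (K 0) (K 0) B B"
    unfolding B_def G_def
    by (subst Phi_UN_third) (auto simp: Phi_UN_last finite_K K_disjoint)
  have "2 * (\<Sum>i\<le>n. \<Sum>j\<le>n. \<Sum>l\<le>n. G i j l) - (\<Sum>i\<le>n. \<Sum>j\<le>n. G i j j)
    = G 0 0 0 + 4 * (\<Sum>j\<in>J. G 0 0 j) + 4 * (\<Sum>i\<in>J. G i i 0) + (\<Sum>i\<in>J. G i i i)
      + 4 * (\<Sum>i\<in>J. \<Sum>j\<in>J - {i}. G i i j) + noncrossing"
    unfolding noncrossing_def s5[symmetric]
  proof (rule noncrossing_sum_split)
    show "G i j l = G i l j" for i j l unfolding G_def by (rule Phi_swap_right)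
    show "G i j j = G j i i" for i j unfolding G_def by (rule Phi_swap_pairs)
  qed
  then have "crossing_tuples + noncrossing = Phi q V V V V - G 0 0 0 - 4 * (\<Sum>j\<in>J. G 0 0 j)
     - 4 * (\<Sum>i\<in>J. G i i 0) - (\<Sum>i\<in>J. G i i i) - 4 * (\<Sum>i\<in>J. \<Sum>j\<in>J - {i}. G i i j)"
    unfolding crossing_tuples_eq by simp
  also have "G 0 0 0 = P * (P - 1) * (P - 2) * (P - 3) / 3" by (simp add: Gii card_K_0 P_def)
  finally show ?thesis unfolding GV s1 s2 s3 s4 by simp
qed


section \<open>The maximum of the arrangement-dependent part\<close>

lemma pair_bound:
  assumes "i \<in> J" "j \<in> J" "i \<noteq> j" "y \<in> V" "y \<notin> K i" "y \<notin> K j"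
  shows "Phi q (K i) (K i) {y} (K j) + Phi q (K j) (K j) {y} (K i) \<le> 2 * (real m ^ 3 - real m) / 3"
  using assms K_subset
  by (intro Phi_XXyY_plus_Phi_YYyX_le finite_K K_disjoint inj_sub card_K) auto

lemma Phi_third_points: "Phi q A A C D = (\<Sum>y\<in>C. Phi q A A {y} D)"
  by (subst (1 2) Phi_swap_right) (simp add: Phi_move_last)

lemma G_third_le:
  assumes "i \<in> J" "j \<in> J" "i \<noteq> j" "l \<noteq> i" "l \<noteq> j"
  shows "G i l j + G j l i \<le> real (card (K l)) * (2 * (real m ^ 3 - real m) / 3)"
proof -
  have "G i l j + G j l i = (\<Sum>y\<in>K l. Phi q (K i) (K i) {y} (K j) + Phi q (K j) (K j) {y} (K i))"
    unfolding G_def Phi_third_points[of _ "K l"] by (rule sum.distrib[symmetric])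
  also have "\<dots> \<le> (\<Sum>y\<in>K l. 2 * (real m ^ 3 - real m) / 3)"
    using assms by (intro sum_mono pair_bound) (auto simp: K_def)
  finally show ?thesis by simp
qed

text \<open>The four summands bound the four summands of \<open>noncrossing\<close> in turn: part 0
  against \<open>B\<close>, two parts of size \<open>m\<close>, two such parts seen from the
  \<open>p\<close> vertices of part 0, and two such parts seen from the \<open>m\<close> vertices of
  a third. They are left in the shape that the sums over pairs of parts produce.\<close>

definition noncrossing_max :: real where
  "noncrossing_max = 2 * ((real p)\<^sup>2 * ((real m * real n)\<^sup>2 - 1) / 3)
     + real n * (real n - 1) * (2 * ((real m)\<^sup>2 * ((real m)\<^sup>2 - 1) / 3)) / 2
     + 4 * (real n * (real n - 1) * (real p * (2 * (real m ^ 3 - real m) / 3)) / 2)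
     + 2 * (real n * ((real n - 1) * (real n - 2) * (real m * (2 * (real m ^ 3 - real m) / 3)) / 2))"

text \<open>\<open>B\<close> has to be the reference set, since its size divides that of
  \<open>K 0\<close>; hence the exchange of pairs. The factor \<open>k\<close> times
  \<open>m * n\<close> is absorbed into \<open>p\<close>.\<close>

lemma Phi_BB00: "Phi q (K 0) (K 0) B B = (real p)\<^sup>2 * ((real m * real n)\<^sup>2 - 1) / 3
   - 2 * (\<Sum>x\<in>B. \<Sum>y\<in>B. ((real (below q (K 0) x) - real k * real (below q B x))
      - (real (below q (K 0) y) - real k * real (below q B y)))\<^sup>2)"
proof -
  have "Phi q B B (K 0) (K 0) = (real k)\<^sup>2 * (real (card B))\<^sup>2 * ((real (card B))\<^sup>2 - 1) / 3
   - 2 * (\<Sum>x\<in>B. \<Sum>y\<in>B. ((real (below q (K 0) x) - real k * real (below q B x))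
      - (real (below q (K 0) y) - real k * real (below q B y)))\<^sup>2)"
    by (rule Phi_XXYY)
      (use K_0_B inj_V in \<open>auto simp: finite_B finite_K card_B card_K_0 p_eq Int_commute Un_commute\<close>)
  then show ?thesis
    by (simp add: card_B p_eq power_mult_distrib mult_ac Phi_swap_pairs[of q B])
qed

lemma G_ijj: 
  assumes "i \<in> J" "j \<in> J" "i \<noteq> j"
  shows "G i j j = (real m)\<^sup>2 * ((real m)\<^sup>2 - 1) / 3
   - 2 * (\<Sum>x\<in>K i. \<Sum>y\<in>K i. ((real (below q (K j) x) - real (below q (K i) x))
      - (real (below q (K j) y) - real (below q (K i) y)))\<^sup>2)"
proof -
  have "G i j j = (real 1)\<^sup>2 * (real (card (K i)))\<^sup>2 * ((real (card (K i)))\<^sup>2 - 1) / 3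
   - 2 * (\<Sum>x\<in>K i. \<Sum>y\<in>K i. ((real (below q (K j) x) - real 1 * real (below q (K i) x))
      - (real (below q (K j) y) - real 1 * real (below q (K i) y)))\<^sup>2)"
    unfolding G_def
    by (rule Phi_XXYY)
      (use assms K_subset in \<open>auto simp: finite_K card_K K_disjoint intro!: inj_sub\<close>)
  then show ?thesis using assms by (simp add: card_K)
qed

text \<open>The groups are bounded separately: in the first two a sum of squares is dropped, in the
  other two each pair of parts is estimated from every vertex of the remaining part.\<close>

lemma noncrossing_le: "noncrossing \<le> noncrossing_max"
proof -
  have 1: "Phi q (K 0) (K 0) B B \<le> (real p)\<^sup>2 * ((real m * real n)\<^sup>2 - 1) / 3"
    unfolding Phi_BB00 by (simp add: sum_nonneg)
  have 2: "(\<Sum>i\<in>J. \<Sum>j\<in>J - {i}. G i j j)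
    \<le> real (card J) * (real (card J) - 1) * (2 * ((real m)\<^sup>2 * ((real m)\<^sup>2 - 1) / 3)) / 2"
  proof (rule sum_off_diagonal_le)
    fix i j assume ij: "i \<in> J" "j \<in> J" "i \<noteq> j"
    have "G i j j \<le> (real m)\<^sup>2 * ((real m)\<^sup>2 - 1) / 3" if "i \<in> J" "j \<in> J" "i \<noteq> j" for i j
      unfolding G_ijj[OF that] by (simp add: sum_nonneg)
    from this[OF ij] this[OF ij(2,1)] ij(3)
    show "G i j j + G j i i \<le> 2 * ((real m)\<^sup>2 * ((real m)\<^sup>2 - 1) / 3)" by simp
  qed simp
  have 3: "(\<Sum>i\<in>J. \<Sum>j\<in>J - {i}. G i 0 j)
    \<le> real (card J) * (real (card J) - 1) * (real p * (2 * (real m ^ 3 - real m) / 3)) / 2"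
    by (rule sum_off_diagonal_le, simp, subst card_K_0[symmetric], rule G_third_le) auto
  have 4: "(\<Sum>i\<in>J - {l}. \<Sum>j\<in>J - {l} - {i}. G i l j)
    \<le> (real n - 1) * (real n - 2) * (real m * (2 * (real m ^ 3 - real m) / 3)) / 2" if "l \<in> J" for l
  proof -
    have "(\<Sum>i\<in>J - {l}. \<Sum>j\<in>J - {l} - {i}. G i l j) \<le> real (card (J - {l})) *
      (real (card (J - {l})) - 1) * (real m * (2 * (real m ^ 3 - real m) / 3)) / 2"
      by (rule sum_off_diagonal_le, simp, subst card_K[OF that, symmetric], rule G_third_le) auto
    then show ?thesis using that by (simp add: of_nat_diff)
  qed
  have 5: "(\<Sum>l\<in>J. \<Sum>i\<in>J - {l}. \<Sum>j\<in>J - {l} - {i}. G i l j)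
    \<le> (\<Sum>l\<in>J. (real n - 1) * (real n - 2) * (real m * (2 * (real m ^ 3 - real m) / 3)) / 2)"
    by (rule sum_mono) (rule 4)
  have c: "real (card J) = real n" by simp
  show ?thesis
    using 1 2[unfolded c] 3[unfolded c] 5[unfolded sum_constant c]
    unfolding noncrossing_def noncrossing_max_def by linarith
qed

text \<open>Each hypothesis removes one loss: \<open>bal0\<close> and \<open>bal2\<close> make all
  deviations vanish in the sums of squares for \<open>K 0\<close> against \<open>B\<close> and for
  two parts of size \<open>m\<close>, and \<open>bal1\<close> is alternation of two parts as seen
  from any vertex. Conditions for \<open>i < j\<close> suffice, because each estimate is symmetric
  in the two parts.\<close>

lemma noncrossing_eq:
  assumes bal0: "\<And>x. x \<in> B \<Longrightarrow> below q (K 0) x = k * below q B x"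
    and bal1: "\<And>i j v. i \<in> J \<Longrightarrow> j \<in> J \<Longrightarrow> i < j \<Longrightarrow> v \<in> V \<Longrightarrow>
      below q (K j) v \<le> below q (K i) v \<and> below q (K i) v \<le> Suc (below q (K j) v)"
    and bal2: "\<And>i j x. i \<in> J \<Longrightarrow> j \<in> J \<Longrightarrow> i < j \<Longrightarrow> x \<in> K i \<Longrightarrow> below q (K j) x = below q (K i) x"
  shows "noncrossing = noncrossing_max"
proof -
  have pair: "Phi q (K i) (K i) {y} (K j) + Phi q (K j) (K j) {y} (K i) = 2 * (real m ^ 3 - real m) / 3"
    if "i \<in> J" "j \<in> J" "i < j" "y \<in> V" "y \<notin> K i" "y \<notin> K j" for i j y
  proof (rule Phi_XXyY_plus_Phi_YYyX_eq)
    have sub: "insert y (K i \<union> K j) \<subseteq> V" using that(4) K_subset by auto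
    then show "inj_on q (insert y (K i \<union> K j))" by (rule inj_sub)
    show "below q (K j) v \<le> below q (K i) v \<and> below q (K i) v \<le> Suc (below q (K j) v)"
      if "v \<in> insert y (K i \<union> K j)" for v
      using bal1 \<open>i \<in> J\<close> \<open>j \<in> J\<close> \<open>i < j\<close> sub that by blast
  qed (use that in \<open>auto simp: finite_K card_K K_disjoint\<close>)
  have third: "G i l j + G j l i = real (card (K l)) * (2 * (real m ^ 3 - real m) / 3)"
    if "i \<in> J" "j \<in> J" "i \<noteq> j" "l \<noteq> i" "l \<noteq> j" for i j l
  proof -
    have *: "G i l j + G j l i = real (card (K l)) * (2 * (real m ^ 3 - real m) / 3)"
      if "i \<in> J" "j \<in> J" "i < j" "l \<noteq> i" "l \<noteq> j" for i j
    proof -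
      have "G i l j + G j l i = (\<Sum>y\<in>K l. Phi q (K i) (K i) {y} (K j) + Phi q (K j) (K j) {y} (K i))"
        unfolding G_def Phi_third_points[of _ "K l"] by (rule sum.distrib[symmetric])
      also have "\<dots> = (\<Sum>y\<in>K l. 2 * (real m ^ 3 - real m) / 3)"
        by (intro sum.cong refl pair) (use that in \<open>auto simp: K_def\<close>)
      finally show ?thesis by simp
    qed
    show ?thesis using *[of i j] *[of j i] that by (cases i j rule: linorder_cases) auto
  qed
  have 1: "Phi q (K 0) (K 0) B B = (real p)\<^sup>2 * ((real m * real n)\<^sup>2 - 1) / 3"
    unfolding Phi_BB00 by (simp add: bal0)
  have 2: "(\<Sum>i\<in>J. \<Sum>j\<in>J - {i}. G i j j)
    = real (card J) * (real (card J) - 1) * (2 * ((real m)\<^sup>2 * ((real m)\<^sup>2 - 1) / 3)) / 2"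
  proof (rule sum_off_diagonal_eq)
    fix i j assume ij: "i \<in> J" "j \<in> J" "i \<noteq> j"
    have *: "G i j j = (real m)\<^sup>2 * ((real m)\<^sup>2 - 1) / 3" if "i \<in> J" "j \<in> J" "i < j" for i j
      using G_ijj[of i j] that bal2[OF that] by simp
    have "G i j j = G j i i" unfolding G_def by (rule Phi_swap_pairs)
    then show "G i j j + G j i i = 2 * ((real m)\<^sup>2 * ((real m)\<^sup>2 - 1) / 3)"
      using *[of i j] *[of j i] ij by (cases i j rule: linorder_cases) auto
  qed simp
  have 3: "(\<Sum>i\<in>J. \<Sum>j\<in>J - {i}. G i 0 j)
    = real (card J) * (real (card J) - 1) * (real p * (2 * (real m ^ 3 - real m) / 3)) / 2"
    by (rule sum_off_diagonal_eq, simp, subst card_K_0[symmetric], rule third) auto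
  have 4: "(\<Sum>i\<in>J - {l}. \<Sum>j\<in>J - {l} - {i}. G i l j)
    = (real n - 1) * (real n - 2) * (real m * (2 * (real m ^ 3 - real m) / 3)) / 2" if "l \<in> J" for l
  proof -
    have "(\<Sum>i\<in>J - {l}. \<Sum>j\<in>J - {l} - {i}. G i l j) = real (card (J - {l})) *
      (real (card (J - {l})) - 1) * (real m * (2 * (real m ^ 3 - real m) / 3)) / 2"
      by (rule sum_off_diagonal_eq, simp, subst card_K[OF that, symmetric], rule third) auto
    then show ?thesis using that by (simp add: of_nat_diff)
  qed
  have 5: "(\<Sum>l\<in>J. \<Sum>i\<in>J - {l}. \<Sum>j\<in>J - {l} - {i}. G i l j)
    = (\<Sum>l\<in>J. (real n - 1) * (real n - 2) * (real m * (2 * (real m ^ 3 - real m) / 3)) / 2)"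
    by (rule sum.cong[OF refl]) (rule 4)
  show ?thesis
    unfolding noncrossing_def noncrossing_max_def 1 2 3 5 by simp
qed

definition min_crossings :: real where
  "min_crossings = phi (real m) (real n) (real p) - 1/12 * (real m)^2 * (real n)^2 + 1/12 * (real p)^2"

text \<open>A polynomial identity in \<open>m\<close>, \<open>n\<close>, \<open>p\<close>, and the
  point where the closed form \<open>phi\<close> is checked. The bracket is the loss against the
  optimum, nonnegative by \<open>noncrossing_le\<close>.\<close>

lemma crossing_tuples_min_crossings:
  "crossing_tuples = 8 * min_crossings + (noncrossing_max - noncrossing)"
proof -
  have "crossing_tuples = (crossing_tuples + noncrossing) - noncrossing_max + (noncrossing_max - noncrossing)"
    by simp
  then show ?thesis
    unfolding crossing_tuples_value noncrossing_max_def min_crossings_def phi_def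
    by (simp add: field_simps power2_eq_square power3_eq_cube power4_eq_xxxx)
qed

end

section \<open>Chords of a circle\<close>

text \<open>Twice the signed area of the triangle, positive for counterclockwise order.\<close>

definition orient :: "complex \<Rightarrow> complex \<Rightarrow> complex \<Rightarrow> real" where
  "orient u v w = (Re v - Re u) * (Im w - Im u) - (Im v - Im u) * (Re w - Re u)"

definition circle_point :: "complex \<Rightarrow> real \<Rightarrow> real \<Rightarrow> complex" where
  "circle_point z r a = z + of_real r * cis a"

text \<open>Half-angles turn the area into a product: sin 2x + sin 2y - sin (2x + 2y) = 4 sin x sin
  y sin (x + y). For increasing angles within one turn every factor has its argument strictly
  between 0 and \<open>pi\<close>, so the sign is visible.\<close>

lemma orient_circle:
  "orient (circle_point z r a) (circle_point z r b) (circle_point z r c)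
    = 4 * r\<^sup>2 * (sin ((b - a) / 2) * sin ((c - b) / 2) * sin ((c - a) / 2))"
proof -
  define x y where "x = (b - a) / 2" and "y = (c - b) / 2"
  have b: "b = a + 2 * x" and c: "c = a + 2 * x + 2 * y" by (simp_all add: x_def y_def field_simps)
  have xy: "(c - a) / 2 = x + y" by (simp add: x_def y_def field_simps)
  have "orient (circle_point z r a) (circle_point z r b) (circle_point z r c)
    = r\<^sup>2 * (sin (b - a) + sin (c - b) - sin (c - a))"
    by (simp add: orient_def circle_point_def sin_diff algebra_simps power2_eq_square)
  also have "sin (b - a) + sin (c - b) - sin (c - a) = sin (2 * x) + sin (2 * y) - sin (2 * x + 2 * y)"
    by (simp add: b c)
  also have "\<dots> = 4 * (sin x * sin y * sin (x + y))"
  proof -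
    have "sin (2 * x) - sin (2 * x) * cos (2 * y) + (sin (2 * y) - cos (2 * x) * sin (2 * y)) = 4 * (sin x * sin y * sin (x + y))"
      unfolding cos_double_sin sin_double sin_add by (simp add: power2_eq_square algebra_simps)
    then show ?thesis using sin_add[of "2 * x" "2 * y"] by linarith
  qed
  finally show ?thesis unfolding xy x_def[symmetric] y_def[symmetric] by simp
qed

lemma orient_circle_pos:
  assumes "r > 0" "0 \<le> a" "a < b" "b < c" "c < 2 * pi"
  shows "orient (circle_point z r a) (circle_point z r b) (circle_point z r c) > 0"
proof -
  have "sin ((b - a) / 2) > 0" "sin ((c - b) / 2) > 0" "sin ((c - a) / 2) > 0"
    using assms by (auto intro!: sin_gt_zero)
  then show ?thesis using assms(1) by (simp add: orient_circle)
qed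

lemma orient_rotate: "orient u v w = orient v w u"
  by (simp add: orient_def algebra_simps)

lemma orient_flip: "orient u v w = - orient u w v"
  by (simp add: orient_def algebra_simps)

lemma orient_endpoint [simp]: "orient u v u = 0" "orient u v v = 0"
  by (simp_all add: orient_def)

lemma orient_affine:
  "orient u v ((1 - t) *\<^sub>R x + t *\<^sub>R y) = (1 - t) * orient u v x + t * orient u v y"
  by (simp add: orient_def algebra_simps)

lemma orient_open_segment: "x \<in> open_segment u v \<Longrightarrow> orient u v x = 0"
  by (auto simp: in_segment orient_affine)

text \<open>The hypotheses say that \<open>a, b, c, d\<close> is a convex quadrilateral in
  counterclockwise order. \<open>D\<close> is twice its area, cut along either diagonal.\<close>

lemma diagonals_meet:
  assumes "orient a b c > 0" "orient a b d > 0" "orient a c d > 0" "orient b c d > 0"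
  shows "open_segment a c \<inter> open_segment b d \<noteq> {}"
proof -
  define D where "D = orient a b d + orient b c d"
  have D: "D = orient a b c + orient a c d" by (simp add: D_def orient_def algebra_simps)
  have pos: "D > 0" using assms by (simp add: D_def)
  \<comment> \<open>The line through \<open>b, d\<close> divides the segment from \<open>a\<close>
    to \<open>c\<close> in the ratio of the areas of \<open>abd\<close> and \<open>bcd\<close>;
    likewise for the other diagonal.\<close>
  define s t where "s = orient a b d / D" and "t = orient a b c / D"
  have s: "0 < s" "s < 1" and t: "0 < t" "t < 1"
    using assms pos D by (auto simp: s_def t_def D_def)
  have "D *\<^sub>R ((1 - s) *\<^sub>R a + s *\<^sub>R c) = D *\<^sub>R ((1 - t) *\<^sub>R b + t *\<^sub>R d)"
  proof -
    have "D * s = orient a b d" "D * t = orient a b c" using pos by (auto simp: s_def t_def)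
    then have "D *\<^sub>R ((1 - s) *\<^sub>R a + s *\<^sub>R c) = (D - orient a b d) *\<^sub>R a + orient a b d *\<^sub>R c"
      "D *\<^sub>R ((1 - t) *\<^sub>R b + t *\<^sub>R d) = (D - orient a b c) *\<^sub>R b + orient a b c *\<^sub>R d"
      by (simp_all add: scaleR_add_right right_diff_distrib)
    moreover have "(D - orient a b d) *\<^sub>R a + orient a b d *\<^sub>R c = (D - orient a b c) *\<^sub>R b + orient a b c *\<^sub>R d"
      by (simp add: complex_eq_iff D_def orient_def algebra_simps)
    ultimately show ?thesis by simp
  qed
  then have eq: "(1 - s) *\<^sub>R a + s *\<^sub>R c = (1 - t) *\<^sub>R b + t *\<^sub>R d" using pos by simp
  have "a \<noteq> c" "b \<noteq> d" using assms by (auto simp: orient_def algebra_simps)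
  then have "(1 - s) *\<^sub>R a + s *\<^sub>R c \<in> open_segment a c" "(1 - s) *\<^sub>R a + s *\<^sub>R c \<in> open_segment b d"
    using s t eq by (auto simp: in_segment)
  then show ?thesis by blast
qed

text \<open>Sorting the three angles permutes the arguments of \<open>orient\<close>: evenly if
  \<open>c\<close> lies outside the interval, oddly if it lies between.\<close>

lemma orient_circle_sign:
  assumes "r > 0" "{a, b, c} \<subseteq> {0..<2 * pi}" "a < b" "c \<notin> {a, b}"
  shows "if strictly_between a b c
    then orient (circle_point z r a) (circle_point z r b) (circle_point z r c) < 0
    else orient (circle_point z r a) (circle_point z r b) (circle_point z r c) > 0"
proof -
  let ?P = "circle_point z r"
  consider "c < a" | "a < c" "c < b" | "b < c" using assms(4) by fastforce
  then show ?thesis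
  proof cases
    case 1
    then have "orient (?P c) (?P a) (?P b) > 0" using assms by (intro orient_circle_pos) auto
    then show ?thesis using 1 assms(3) by (simp add: strictly_between_def orient_rotate[of "?P c"])
  next
    case 2
    then have "orient (?P a) (?P c) (?P b) > 0" using assms by (intro orient_circle_pos) auto
    then show ?thesis using 2 by (simp add: strictly_between_def orient_flip[of _ "?P b"])
  next
    case 3
    then have "orient (?P a) (?P b) (?P c) > 0" using assms by (intro orient_circle_pos) auto
    then show ?thesis using 3 assms(3) by (simp add: strictly_between_def)
  qed
qed

text \<open>The arc between \<open>a\<close> and \<open>b\<close> is one side of their chord. A
  common point forces \<open>c\<close> and \<open>d\<close> to strictly opposite sides; conversely,
  interlaced endpoints are the corners of a convex quadrilateral whose diagonals are the
  chords.\<close>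

lemma chords_meet_iff:
  assumes r: "r > 0" and sub: "{a, b, c, d} \<subseteq> {0..<2 * pi}" and "a \<noteq> b" "c \<noteq> d" "{a, b} \<noteq> {c, d}"
  shows "open_segment (circle_point z r a) (circle_point z r b) \<inter>
      open_segment (circle_point z r c) (circle_point z r d) \<noteq> {} \<longleftrightarrow> interlaced a b c d"
proof -
  let ?P = "circle_point z r"
  have *: "open_segment (?P a) (?P b) \<inter> open_segment (?P c) (?P d) \<noteq> {} \<longleftrightarrow> interlaced a b c d"
    if ab: "a < b" and sub: "{a, b, c, d} \<subseteq> {0..<2 * pi}" and cd: "c \<noteq> d" and ne: "{a, b} \<noteq> {c, d}" for a b
  proof
    let ?o = "\<lambda>x. orient (?P a) (?P b) (?P x)"
    have sgn: "if strictly_between a b x then ?o x < 0 else if x \<in> {a, b} then ?o x = 0 else ?o x > 0"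
      if "x \<in> {c, d}" for x
      using orient_circle_sign[OF r, of a b x z] sub that ab
      by (auto simp: strictly_between_def split: if_splits)
    assume "open_segment (?P a) (?P b) \<inter> open_segment (?P c) (?P d) \<noteq> {}"
    then obtain p where p: "p \<in> open_segment (?P a) (?P b)" "p \<in> open_segment (?P c) (?P d)" by blast
    then obtain t where t: "0 < t" "t < 1" "p = (1 - t) *\<^sub>R ?P c + t *\<^sub>R ?P d" by (auto simp: in_segment)
    have "(1 - t) * ?o c + t * ?o d = 0"
      using orient_open_segment[OF p(1)] unfolding t(3) orient_affine .
    then have "?o d = - ((1 - t) / t * ?o c)" using t(1) by (simp add: field_simps)
    moreover have "(1 - t) / t > 0" using t(1,2) by simp
    \<comment> \<open>The remaining possibility is that both values are 0; then \<open>c\<close> and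
      \<open>d\<close> both lie in \<open>{a, b}\<close>, which \<open>cd\<close> and
      \<open>ne\<close> exclude.\<close>
    ultimately have zero: "?o c < 0 \<longleftrightarrow> ?o d > 0" "?o c > 0 \<longleftrightarrow> ?o d < 0"
      by (simp_all only: neg_less_0_iff_less neg_0_less_iff_less zero_less_mult_iff mult_less_0_iff) auto
    show "interlaced a b c d"
      using zero sgn[of c] sgn[of d] cd ne
      by (auto simp: interlaced_def strictly_between_def split: if_splits)
  next
    assume "interlaced a b c d"
    then have il: "strictly_between a b c \<and> \<not> strictly_between a b d \<and> d \<notin> {a, b}
      \<or> strictly_between a b d \<and> \<not> strictly_between a b c \<and> c \<notin> {a, b}"
      by (auto simp: interlaced_def)
    have **: "open_segment (?P a) (?P b) \<inter> open_segment (?P c) (?P d) \<noteq> {}"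
      if bt: "strictly_between a b c" "\<not> strictly_between a b d" "d \<notin> {a, b}" "{c, d} \<subseteq> {0..<2 * pi}" for c d
    proof -
      have ac: "a < c" "c < b" using bt ab by (auto simp: strictly_between_def)
      consider "d < a" | "b < d" using bt(2,3) ab by (fastforce simp: strictly_between_def)
      then show ?thesis
      proof cases
        case 1
        have "open_segment (?P d) (?P c) \<inter> open_segment (?P a) (?P b) \<noteq> {}"
          by (rule diagonals_meet; rule orient_circle_pos[OF r]) (use 1 ac sub bt in auto)
        then show ?thesis by (simp add: open_segment_commute Int_commute)
      next
        case 2
        show ?thesis
          by (rule diagonals_meet; rule orient_circle_pos[OF r]) (use 2 ac sub bt in auto)
      qed
    qed
    show "open_segment (?P a) (?P b) \<inter> open_segment (?P c) (?P d) \<noteq> {}"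
      using il **[of c d] **[of d c] sub by (auto simp: open_segment_commute)
  qed
  show ?thesis
  proof (cases "a < b")
    case True
    then show ?thesis using * assms by blast
  next
    case False
    then have "b < a" using assms(3) by simp
    from *[OF this] assms show ?thesis
      by (simp add: open_segment_commute[of "?P a"] interlaced_swap_left[of a] insert_commute)
  qed
qed

lemma edge_interior_pair: "edge_interior f {u, v} = open_segment (f u) (f v)"
  by (simp add: edge_interior_def open_segment_def segment_convex_hull)

lemma edge_interior_shared_endpoint:
  assumes "{a, b, c} \<subseteq> {0..<2 * pi}" "a \<noteq> b" "a \<noteq> c" "b \<noteq> c"
  shows "edge_interior cis {a, b} \<inter> edge_interior cis {a, c} = {}"
proof -
  have "\<not> interlaced a b a c" by (simp add: interlaced_def)
  moreover have "{a, b} \<noteq> {a, c}" using assms by (simp add: doubleton_eq_iff)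
  ultimately show ?thesis
    using chords_meet_iff[of 1 a b a c 0] assms by (simp add: edge_interior_pair circle_point_def)
qed

text \<open>Along the second chord the orientation relative to the first is affine and takes
  different values at the ends, so it has a single zero.\<close>

lemma edge_interior_meet_once:
  assumes "{a, b, c, d} \<subseteq> {0..<2 * pi}" "a \<noteq> b" "c \<noteq> d" "{a, b} \<noteq> {c, d}"
    and "p \<in> edge_interior cis {a, b} \<inter> edge_interior cis {c, d}"
    and "p' \<in> edge_interior cis {a, b} \<inter> edge_interior cis {c, d}"
  shows "p = p'"
proof -
  have *: "p = p'" if ab: "a < b" and sub: "{a, b, c, d} \<subseteq> {0..<2 * pi}" and ne: "{a, b} \<noteq> {c, d}"
    and p: "p \<in> edge_interior cis {a, b} \<inter> edge_interior cis {c, d}"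
    and p': "p' \<in> edge_interior cis {a, b} \<inter> edge_interior cis {c, d}" for a b
  proof -
    let ?o = "\<lambda>x. orient (cis a) (cis b) x"
    have il: "interlaced a b c d"
      using chords_meet_iff[of 1 a b c d 0] ab ne sub p assms(3)
      by (auto simp: edge_interior_pair circle_point_def)
    have neq: "?o (cis c) \<noteq> ?o (cis d)"
      using orient_circle_sign[of 1 a b c 0] orient_circle_sign[of 1 a b d 0] il ab sub
      by (auto simp: interlaced_def circle_point_def split: if_splits)
    have u: "\<exists>t. x = (1 - t) *\<^sub>R cis c + t *\<^sub>R cis d \<and> t * (?o (cis c) - ?o (cis d)) = ?o (cis c)"
      if "x \<in> edge_interior cis {a, b} \<inter> edge_interior cis {c, d}" for x
    proof -
      from that obtain t where t: "x = (1 - t) *\<^sub>R cis c + t *\<^sub>R cis d"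
        by (auto simp: edge_interior_pair in_segment)
      have "?o x = 0" using that by (simp add: edge_interior_pair orient_open_segment)
      then show ?thesis unfolding t orient_affine by (intro exI[of _ t]) (simp add: algebra_simps)
    qed
    from u[OF p] u[OF p'] neq show ?thesis
      by (metis mult_right_cancel right_minus_eq)
  qed
  show ?thesis
  proof (cases "a < b")
    case True
    then show ?thesis using * assms by blast
  next
    case False
    then have "b < a" using assms(2) by simp
    from *[OF this] assms show ?thesis by (simp add: insert_commute)
  qed
qed

section \<open>Angles in general position\<close>

text \<open>All chords on \<open>A\<close> are considered rather than the edges of a graph, so that
  the angles can be fixed before vertices are assigned to them in any desired order.\<close>

definition no_triple_crossing :: "real set \<Rightarrow> bool" where
  "no_triple_crossing A \<longleftrightarrow> (\<forall>e1 e2 e3. e1 \<subseteq> A \<and> e2 \<subseteq> A \<and> e3 \<subseteq> A \<and> card e1 = 2 \<and> card e2 = 2 \<and> card e3 = 2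
    \<and> e1 \<noteq> e2 \<and> e1 \<noteq> e3 \<and> e2 \<noteq> e3 \<longrightarrow>
    edge_interior cis e1 \<inter> edge_interior cis e2 \<inter> edge_interior cis e3 = {})"

text \<open>
  Chords ending in the new point \<open>t\<close> share an endpoint, so a triple crossing uses one chord \<open>{a, t}\<close> and
  two old chords; their single common point determines \<open>t\<close> from \<open>a\<close>. Only finitely many \<open>t\<close> are bad.
\<close>

lemma no_triple_crossing_insert:
  assumes "finite A" "A \<subseteq> {0..<2 * pi}" "no_triple_crossing A"
  shows "\<exists>t. t \<notin> A \<and> t \<in> {0..<2 * pi} \<and> no_triple_crossing (insert t A)"
proof -
  define E where "E = {e. e \<subseteq> A \<and> card e = 2}"
  have finE: "finite E" unfolding E_def using assms(1) by auto
  define bad where "bad = (\<lambda>e1 e2 a. {t \<in> {0..<2 * pi}. t \<noteq> a \<and>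
    edge_interior cis e1 \<inter> edge_interior cis e2 \<inter> edge_interior cis {a, t} \<noteq> {}})"
  have fin: "finite (bad e1 e2 a)" if e: "e1 \<in> E" "e2 \<in> E" "e1 \<noteq> e2" and a: "a \<in> A" for e1 e2 a
  proof -
    have "t = t'" if t: "t \<in> bad e1 e2 a" "t' \<in> bad e1 e2 a" for t t'
    proof (rule ccontr)
      assume "t \<noteq> t'"
      obtain p p' where p: "p \<in> edge_interior cis e1 \<inter> edge_interior cis e2 \<inter> edge_interior cis {a, t}"
        "p' \<in> edge_interior cis e1 \<inter> edge_interior cis e2 \<inter> edge_interior cis {a, t'}"
        using t unfolding bad_def by blast
      obtain x y u v where xy: "e1 = {x, y}" "x \<noteq> y" "e2 = {u, v}" "u \<noteq> v"
        using e by (auto simp: E_def card_2_iff)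
      have "p = p'"
      proof (rule edge_interior_meet_once)
        show "{x, y, u, v} \<subseteq> {0..<2 * pi}" using e xy assms(2) unfolding E_def by blast
        show "{x, y} \<noteq> {u, v}" using e xy by blast
        show "p \<in> edge_interior cis {x, y} \<inter> edge_interior cis {u, v}"
          "p' \<in> edge_interior cis {x, y} \<inter> edge_interior cis {u, v}" using p xy by blast+
      qed fact+
      moreover have "edge_interior cis {a, t} \<inter> edge_interior cis {a, t'} = {}"
        using t a assms(2) \<open>t \<noteq> t'\<close> by (intro edge_interior_shared_endpoint) (auto simp: bad_def)
      ultimately show False using p by blast
    qed
    then have "\<exists>t. bad e1 e2 a \<subseteq> {t}" by (metis singleton_iff subsetI)
    then show ?thesis using finite_subset by blast
  qed
  let ?Bad = "A \<union> (\<Union>e1\<in>E. \<Union>e2\<in>E - {e1}. \<Union>a\<in>A. bad e1 e2 a)"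
  have "finite ?Bad" using finE assms(1) fin by auto
  moreover have "infinite {0..<2 * pi}" by (simp add: infinite_Ico)
  ultimately obtain t where t: "t \<in> {0..<2 * pi}" "t \<notin> ?Bad"
    by (meson finite_subset subsetI)
  have one: "edge_interior cis e1 \<inter> edge_interior cis e2 \<inter> edge_interior cis e3 = {}"
    if e: "e1 \<in> E" "e2 \<in> E" "e1 \<noteq> e2" "e3 \<subseteq> insert t A" "card e3 = 2" "t \<in> e3" for e1 e2 e3
  proof -
    obtain a where a: "e3 = {a, t}" "a \<noteq> t"
      using e(5,6) unfolding card_2_iff by (metis doubleton_eq_iff insertE singletonD)
    then have "a \<in> A" using e by auto
    then have "t \<notin> bad e1 e2 a" using t e by blast
    then show ?thesis using t a by (auto simp: bad_def)
  qed
  have two: "edge_interior cis e1 \<inter> edge_interior cis e2 = {}"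
    if e: "e1 \<subseteq> insert t A" "e2 \<subseteq> insert t A" "card e1 = 2" "card e2 = 2" "e1 \<noteq> e2" "t \<in> e1" "t \<in> e2" for e1 e2
  proof -
    obtain a where a: "e1 = {t, a}" "a \<noteq> t"
      using e(3,6) unfolding card_2_iff by (metis doubleton_eq_iff insertE singletonD)
    obtain b where b: "e2 = {t, b}" "b \<noteq> t"
      using e(4,7) unfolding card_2_iff by (metis doubleton_eq_iff insertE singletonD)
    show ?thesis unfolding a b
    proof (rule edge_interior_shared_endpoint)
      show "{t, a, b} \<subseteq> {0..<2 * pi}" using a b e(1,2) t(1) assms(2) by blast
      show "a \<noteq> b" using a b e(5) by blast
      show "t \<noteq> a" "t \<noteq> b" using a b by blast+
    qed
  qed
  have E: "e \<in> E" if "e \<subseteq> insert t A" "card e = 2" "t \<notin> e" for e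
    using that by (auto simp: E_def)
  have "no_triple_crossing (insert t A)"
    unfolding no_triple_crossing_def
  proof (intro allI impI, elim conjE)
    fix e1 e2 e3
    assume e: "e1 \<subseteq> insert t A" "e2 \<subseteq> insert t A" "e3 \<subseteq> insert t A" "card e1 = 2" "card e2 = 2" "card e3 = 2"
      "e1 \<noteq> e2" "e1 \<noteq> e3" "e2 \<noteq> e3"
    consider "t \<notin> e1" "t \<notin> e2" "t \<notin> e3" | "t \<in> e1" "t \<in> e2" | "t \<in> e1" "t \<in> e3" | "t \<in> e2" "t \<in> e3"
      | "t \<in> e1" "t \<notin> e2" "t \<notin> e3" | "t \<notin> e1" "t \<in> e2" "t \<notin> e3" | "t \<notin> e1" "t \<notin> e2" "t \<in> e3" by blast
    then show "edge_interior cis e1 \<inter> edge_interior cis e2 \<inter> edge_interior cis e3 = {}"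
    proof cases
      case 1
      then have "e1 \<subseteq> A" "e2 \<subseteq> A" "e3 \<subseteq> A" using e by auto
      then show ?thesis using assms(3) e unfolding no_triple_crossing_def by blast
    next
      case 2 then show ?thesis using two[of e1 e2] e by blast
    next
      case 3 then show ?thesis using two[of e1 e3] e by blast
    next
      case 4 then show ?thesis using two[of e2 e3] e by blast
    next
      case 5 then show ?thesis using one[of e2 e3 e1] E e by blast
    next
      case 6 then show ?thesis using one[of e1 e3 e2] E e by blast
    next
      case 7 then show ?thesis using one[of e1 e2 e3] E e by blast
    qed
  qed
  then show ?thesis using t by blast
qed

lemma no_triple_crossing_exists:
  "\<exists>A. finite A \<and> card A = N \<and> A \<subseteq> {0..<2 * pi} \<and> no_triple_crossing A"
proof (induction N)
  case 0
  have "no_triple_crossing {}" by (auto simp: no_triple_crossing_def)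
  then show ?case by (intro exI[of _ "{}"]) simp
next
  case (Suc N)
  then obtain A where A: "finite A" "card A = N" "A \<subseteq> {0..<2 * pi}" "no_triple_crossing A" by blast
  then obtain t where "t \<notin> A" "t \<in> {0..<2 * pi}" "no_triple_crossing (insert t A)"
    using no_triple_crossing_insert by blast
  then show ?case using A by (intro exI[of _ "insert t A"]) simp
qed

section \<open>Between drawings and interlaced tuples\<close>

lemma crossings_eq_interlaced_tuples:
  fixes c :: "'a \<Rightarrow> nat"
  assumes V: "finite V" "inj_on \<theta> V" "\<theta> ` V \<subseteq> {0..<2 * pi}" and r: "r > 0"
    and f: "\<And>v. v \<in> V \<Longrightarrow> f v = circle_point z r (\<theta> v)"
    and E: "E = {{u, v} | u v. u \<in> V \<and> v \<in> V \<and> c u \<noteq> c v}"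
  shows "8 * real (card (crossings E f)) = (\<Sum>x\<in>V. \<Sum>y\<in>V. \<Sum>u\<in>V. \<Sum>v\<in>V.
      of_bool (interlaced (\<theta> x) (\<theta> y) (\<theta> u) (\<theta> v) \<and> c x \<noteq> c y \<and> c u \<noteq> c v))"
proof -
  define P where "P = (\<lambda>(x, y, u, v). interlaced (\<theta> x) (\<theta> y) (\<theta> u) (\<theta> v) \<and> c x \<noteq> c y \<and> c u \<noteq> c v)"
  define T where "T = {\<tau> \<in> V \<times> V \<times> V \<times> V. P \<tau>}"
  define h :: "'a \<times> 'a \<times> 'a \<times> 'a \<Rightarrow> 'a set set" where "h = (\<lambda>(x, y, u, v). {{x, y}, {u, v}})"
  have finT: "finite T" using V(1) by (simp add: T_def)
  have meet: "edge_interior f {x, y} \<inter> edge_interior f {u, v} \<noteq> {} \<longleftrightarrow> interlaced (\<theta> x) (\<theta> y) (\<theta> u) (\<theta> v)"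
    if xyuv: "x \<in> V" "y \<in> V" "u \<in> V" "v \<in> V" "x \<noteq> y" "u \<noteq> v" "{x, y} \<noteq> {u, v}" for x y u v
  proof -
    have "\<theta> x \<noteq> \<theta> y" "\<theta> u \<noteq> \<theta> v" using xyuv V(2) by (auto dest: inj_onD)
    moreover have "{\<theta> x, \<theta> y} \<noteq> {\<theta> u, \<theta> v}"
    proof
      assume "{\<theta> x, \<theta> y} = {\<theta> u, \<theta> v}"
      then have "\<theta> ` {x, y} = \<theta> ` {u, v}" by simp
      then have "{x, y} = {u, v}" using xyuv V(2) by (subst (asm) inj_on_image_eq_iff) auto
      then show False using xyuv by simp
    qed
    moreover have "{\<theta> x, \<theta> y, \<theta> u, \<theta> v} \<subseteq> {0..<2 * pi}" using xyuv V(3) by blast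
    ultimately show ?thesis
      unfolding edge_interior_pair using xyuv by (simp add: f chords_meet_iff[OF r])
  qed
  have dist: "distinct [x, y, u, v]" if "(x, y, u, v) \<in> T" for x y u v
    using that interlaced_distinct[of "\<theta> x" "\<theta> y" "\<theta> u" "\<theta> v"] by (auto simp: T_def P_def)
  have img: "h ` T = crossings E f"
  proof (intro set_eqI iffI)
    fix w assume "w \<in> h ` T"
    then obtain x y u v where w: "(x, y, u, v) \<in> T" "w = {{x, y}, {u, v}}" by (auto simp: h_def)
    have d: "x \<noteq> y" "u \<noteq> v" "{x, y} \<noteq> {u, v}" using dist[OF w(1)] by (auto simp: doubleton_eq_iff)
    have m: "x \<in> V" "y \<in> V" "u \<in> V" "v \<in> V" "c x \<noteq> c y" "c u \<noteq> c v" "interlaced (\<theta> x) (\<theta> y) (\<theta> u) (\<theta> v)"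
      using w(1) by (auto simp: T_def P_def)
    have "{x, y} \<in> E" "{u, v} \<in> E" using m E by blast+
    moreover have "edge_interior f {x, y} \<inter> edge_interior f {u, v} \<noteq> {}"
      using meet[OF m(1-4) d] m(7) by simp
    ultimately show "w \<in> crossings E f" unfolding crossings_def using w(2) d(3) by blast
  next
    fix w assume "w \<in> crossings E f"
    then obtain e e' where e: "w = {e, e'}" "e \<in> E" "e' \<in> E" "e \<noteq> e'" "edge_interior f e \<inter> edge_interior f e' \<noteq> {}"
      unfolding crossings_def by blast
    obtain x y where xy: "e = {x, y}" "x \<in> V" "y \<in> V" "c x \<noteq> c y" using e(2) E by blast
    obtain u v where uv: "e' = {u, v}" "u \<in> V" "v \<in> V" "c u \<noteq> c v" using e(3) E by blast
    have "interlaced (\<theta> x) (\<theta> y) (\<theta> u) (\<theta> v)"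
      using meet[OF xy(2,3) uv(2,3)] e(4,5) xy uv by auto
    then have "(x, y, u, v) \<in> T" using xy uv by (simp add: T_def P_def)
    moreover have "w = h (x, y, u, v)" using e(1) xy(1) uv(1) by (simp add: h_def)
    ultimately show "w \<in> h ` T" by blast
  qed
  \<comment> \<open>The eight tuples come from reordering each edge and exchanging the edges; they
    are different because the four entries are distinct.\<close>
  have fiber: "card {\<tau> \<in> T. h \<tau> = w} = 8" if w: "w \<in> h ` T" for w
  proof -
    obtain x y u v where t: "(x, y, u, v) \<in> T" "w = {{x, y}, {u, v}}" using w by (auto simp: h_def)
    have il: "interlaced (\<theta> x) (\<theta> y) (\<theta> u) (\<theta> v)" using t(1) by (simp add: T_def P_def)
    have all: "interlaced (\<theta> y) (\<theta> x) (\<theta> u) (\<theta> v)" "interlaced (\<theta> x) (\<theta> y) (\<theta> v) (\<theta> u)"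
      "interlaced (\<theta> y) (\<theta> x) (\<theta> v) (\<theta> u)" "interlaced (\<theta> u) (\<theta> v) (\<theta> x) (\<theta> y)"
      "interlaced (\<theta> u) (\<theta> v) (\<theta> y) (\<theta> x)" "interlaced (\<theta> v) (\<theta> u) (\<theta> x) (\<theta> y)"
      "interlaced (\<theta> v) (\<theta> u) (\<theta> y) (\<theta> x)"
      using il interlaced_swap_left interlaced_swap_right interlaced_swap_pairs by metis+
    have d: "x \<noteq> y" "x \<noteq> u" "x \<noteq> v" "y \<noteq> u" "y \<noteq> v" "u \<noteq> v" using dist[OF t(1)] by auto
    have "{\<tau> \<in> T. h \<tau> = w} = {(x, y, u, v), (y, x, u, v), (x, y, v, u), (y, x, v, u),
      (u, v, x, y), (u, v, y, x), (v, u, x, y), (v, u, y, x)}" (is "?L = ?R")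
    proof
      show "?L \<subseteq> ?R"
      proof
        fix \<tau> assume "\<tau> \<in> ?L"
        then obtain a b a' b' where \<tau>: "\<tau> = (a, b, a', b')" "{{a, b}, {a', b'}} = {{x, y}, {u, v}}"
          using t(2) by (cases \<tau>) (auto simp: h_def)
        then show "\<tau> \<in> ?R" unfolding \<tau>(1) by (auto simp: doubleton_eq_iff)
      qed
      show "?R \<subseteq> ?L"
        using t il all by (auto simp: T_def P_def h_def insert_commute)
    qed
    also have "card \<dots> = 8" using d by simp
    finally show ?thesis .
  qed
  have "(\<Sum>x\<in>V. \<Sum>y\<in>V. \<Sum>u\<in>V. \<Sum>v\<in>V.
      of_bool (interlaced (\<theta> x) (\<theta> y) (\<theta> u) (\<theta> v) \<and> c x \<noteq> c y \<and> c u \<noteq> c v))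
    = (\<Sum>\<tau>\<in>V \<times> V \<times> V \<times> V. of_bool (P \<tau>) :: real)"
    by (simp add: sum.cartesian_product P_def split_def)
  also have "\<dots> = (\<Sum>\<tau>\<in>T. 1)"
    unfolding T_def using V(1) by (intro sum.mono_neutral_cong_right) auto
  also have "\<dots> = (\<Sum>w\<in>h ` T. \<Sum>\<tau>\<in>{\<tau> \<in> T. h \<tau> = w}. 1)" by (rule sum.image_gen[OF finT])
  also have "\<dots> = (\<Sum>w\<in>h ` T. 8)" by (intro sum.cong refl) (simp add: fiber)
  also have "\<dots> = 8 * real (card (crossings E f))" by (simp add: img)
  finally show ?thesis by simp
qed

lemma outerplanar_drawing_angles:
  assumes "outerplanar_drawing V E f"
  obtains \<theta> z r where "r > 0" "inj_on \<theta> V" "\<theta> ` V \<subseteq> {0..<2 * pi}"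
    "\<And>v. v \<in> V \<Longrightarrow> f v = circle_point z r (\<theta> v)"
proof -
  obtain z r where zr: "r > 0" "f ` V \<subseteq> sphere z r" and inj: "inj_on f V"
    using assms unfolding outerplanar_drawing_def by blast
  define \<theta> where "\<theta> = (\<lambda>v. Arg2pi (f v - z))"
  have f: "f v = circle_point z r (\<theta> v)" if "v \<in> V" for v
  proof -
    have "norm (f v - z) = r" using zr(2) that by (auto simp: dist_norm norm_minus_commute)
    then have "f v - z = of_real r * cis (\<theta> v)"
      using Arg2pi_eq[of "f v - z"] unfolding \<theta>_def by (simp add: cis_conv_exp)
    then show ?thesis by (simp add: circle_point_def algebra_simps)
  qed
  have "inj_on \<theta> V"
  proof (rule inj_onI)
    fix u v assume "u \<in> V" "v \<in> V" "\<theta> u = \<theta> v"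
    then show "u = v" using f inj by (metis inj_onD)
  qed
  moreover have "\<theta> ` V \<subseteq> {0..<2 * pi}" by (auto simp: \<theta>_def Arg2pi_ge_0 Arg2pi_lt_2pi)
  ultimately show thesis using that[OF zr(1)] f by blast
qed

text \<open>Three edges through one point would map to three different chords of a set in general
  position.\<close>

lemma outerplanar_drawing_with_order:
  fixes pos :: "'a \<Rightarrow> nat"
  assumes V: "finite V" "inj_on pos V" and E: "\<And>e. e \<in> E \<Longrightarrow> e \<subseteq> V \<and> card e = 2"
  obtains \<theta> where "\<theta> ` V \<subseteq> {0..<2 * pi}" "outerplanar_drawing V E (\<lambda>v. cis (\<theta> v))"
    "\<And>u v. u \<in> V \<Longrightarrow> v \<in> V \<Longrightarrow> \<theta> u < \<theta> v \<longleftrightarrow> pos u < pos v"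
proof -
  \<comment> \<open>\<open>pos\<close> may leave gaps, so one angle is provided for every value up
    to its maximum and the surplus angles stay empty.\<close>
  define N where "N = Suc (Max (pos ` V))"
  have posN: "pos v < N" if "v \<in> V" for v
    using that V(1) by (simp add: N_def less_Suc_eq_le)
  obtain A where A: "finite A" "card A = N" "A \<subseteq> {0..<2 * pi}" "no_triple_crossing A"
    using no_triple_crossing_exists by blast
  define L where "L = sorted_list_of_set A"
  have L: "length L = N" "set L = A" "sorted_wrt (<) L"
    using A by (auto simp: L_def)
  define \<theta> where "\<theta> = (\<lambda>v. L ! pos v)"
  have \<theta>A: "\<theta> v \<in> A" if "v \<in> V" for v
    unfolding \<theta>_def L(2)[symmetric] by (rule nth_mem) (simp add: L(1) posN that)
  have less: "\<theta> u < \<theta> v" if "u \<in> V" "v \<in> V" "pos u < pos v" for u v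
    unfolding \<theta>_def by (rule sorted_wrt_nth_less[OF L(3)]) (use that posN L(1) in auto)
  have iff: "\<theta> u < \<theta> v \<longleftrightarrow> pos u < pos v" if "u \<in> V" "v \<in> V" for u v
    using less[OF that] less[OF that(2,1)]
    by (metis \<theta>_def less_asym linorder_neqE_nat less_irrefl)
  have inj: "inj_on \<theta> V"
  proof (rule inj_onI)
    fix u v assume uv: "u \<in> V" "v \<in> V" "\<theta> u = \<theta> v"
    then have "pos u = pos v" using iff[of u v] iff[of v u] by (metis less_irrefl linorder_neqE_nat)
    then show "u = v" using V(2) uv by (meson inj_onD)
  qed
  have range: "\<theta> ` V \<subseteq> {0..<2 * pi}" using \<theta>A A(3) by blast
  have injcis: "inj_on (\<lambda>v. cis (\<theta> v)) V"
  proof (rule inj_onI)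
    fix u v assume uv: "u \<in> V" "v \<in> V" "cis (\<theta> u) = cis (\<theta> v)"
    have "\<theta> u \<in> {0..<2 * pi}" "\<theta> v \<in> {0..<2 * pi}" using uv range by blast+
    moreover have "Arg2pi (cis a) = a" if "a \<in> {0..<2 * pi}" for a
      using that by (intro Arg2pi_unique[of 1]) (auto simp: cis_conv_exp)
    ultimately have "\<theta> u = \<theta> v" using uv(3) by metis
    then show "u = v" using inj uv by (meson inj_onD)
  qed
  have finE: "finite E" by (rule finite_subset[of _ "Pow V"]) (use E V(1) in auto)
  have "card {e \<in> E. z \<in> edge_interior (\<lambda>v. cis (\<theta> v)) e} \<le> 2" for z
  proof (rule ccontr)
    let ?S = "{e \<in> E. z \<in> edge_interior (\<lambda>v. cis (\<theta> v)) e}"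
    assume "\<not> card ?S \<le> 2"
    then have "3 \<le> card ?S" by simp
    then obtain S where S: "S \<subseteq> ?S" "card S = 3" by (meson obtain_subset_with_card_n)
    then obtain e1 e2 e3 where e: "S = {e1, e2, e3}" "e1 \<noteq> e2" "e1 \<noteq> e3" "e2 \<noteq> e3"
      by (auto simp: card_3_iff)
    have mem: "\<theta> ` e \<subseteq> A \<and> card (\<theta> ` e) = 2 \<and> z \<in> edge_interior cis (\<theta> ` e)" if "e \<in> S" for e
    proof -
      have "e \<in> E" "z \<in> edge_interior (\<lambda>v. cis (\<theta> v)) e" using that S by blast+
      moreover have "card (\<theta> ` e) = card e"
        using E[OF \<open>e \<in> E\<close>] inj by (meson card_image inj_on_subset)
      moreover have "edge_interior (\<lambda>v. cis (\<theta> v)) e = edge_interior cis (\<theta> ` e)"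
        by (simp add: edge_interior_def image_image)
      moreover have "\<theta> ` e \<subseteq> A" using E[OF \<open>e \<in> E\<close>] \<theta>A by blast
      ultimately show ?thesis using E[OF \<open>e \<in> E\<close>] by simp
    qed
    have neq: "\<theta> ` e \<noteq> \<theta> ` e'" if "e \<in> S" "e' \<in> S" "e \<noteq> e'" for e e'
    proof -
      have "e \<subseteq> V" "e' \<subseteq> V" using that S(1) E by blast+
      then show ?thesis using inj_on_image_eq_iff[OF inj] that(3) by blast
    qed
    have S3: "e1 \<in> S" "e2 \<in> S" "e3 \<in> S" using e(1) by auto
    have "edge_interior cis (\<theta> ` e1) \<inter> edge_interior cis (\<theta> ` e2) \<inter> edge_interior cis (\<theta> ` e3) = {}"
      by (rule A(4)[unfolded no_triple_crossing_def, rule_format])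
        (use mem[OF S3(1)] mem[OF S3(2)] mem[OF S3(3)] neq[OF S3(1,2) e(2)] neq[OF S3(1,3) e(3)]
        neq[OF S3(2,3) e(4)] in simp)
    then show False using mem[OF S3(1)] mem[OF S3(2)] mem[OF S3(3)] by blast
  qed
  moreover have "\<exists>z r. 0 < r \<and> (\<lambda>v. cis (\<theta> v)) ` V \<subseteq> sphere z r"
    by (intro exI[of _ 0] exI[of _ 1]) auto
  ultimately have "outerplanar_drawing V E (\<lambda>v. cis (\<theta> v))"
    unfolding outerplanar_drawing_def using injcis finE by simp
  then show thesis using that[OF range _ iff] by blast
qed


section \<open>The optimal arrangement\<close>

lemma multipartite_verts_eq:
  "multipartite_verts (p # replicate n m) = {(i, j). i = 0 \<and> j < p \<or> 1 \<le> i \<and> i \<le> n \<and> j < m}"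
  by (auto simp: multipartite_verts_def nth_Cons' split: if_splits)

lemma colored_arrangement_multipartite:
  assumes "inj_on q (multipartite_verts (p # replicate n m))" "p = k * (m * n)"
  shows "colored_arrangement q (multipartite_verts (p # replicate n m)) fst m n p k"
proof
  let ?V = "multipartite_verts (p # replicate n m)"
  have "?V \<subseteq> {..n} \<times> {..<p + m}" by (auto simp: multipartite_verts_eq)
  then show "finite ?V" by (rule finite_subset) simp
  show "fst v \<le> n" if "v \<in> ?V" for v using that by (auto simp: multipartite_verts_eq)
  have "{v \<in> ?V. fst v = 0} = Pair 0 ` {..<p}" by (auto simp: multipartite_verts_eq)
  then show "card {v \<in> ?V. fst v = 0} = p" by (simp add: card_image inj_on_def)
  show "card {v \<in> ?V. fst v = i} = m" if "1 \<le> i" "i \<le> n" for i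
  proof -
    have "{v \<in> ?V. fst v = i} = Pair i ` {..<m}" using that by (auto simp: multipartite_verts_eq)
    then show ?thesis by (simp add: card_image inj_on_def)
  qed
qed (use assms in auto)

text \<open>
  The \<open>s\<close>-th vertex of the parts \<open>1, \<dots>, n\<close> in the round-robin order gets slot \<open>s * (k + 1)\<close>; the
  next \<open>k\<close> slots hold vertices of part 0.
\<close>

definition slot :: "nat \<Rightarrow> nat \<Rightarrow> nat \<times> nat \<Rightarrow> nat" where
  "slot k n = (\<lambda>(i, j). if i = 0 then j div k * Suc k + Suc (j mod k) else (j * n + (i - 1)) * Suc k)"

lemma slot_div_mod:
  assumes "k > 0"
  shows "slot k n (0, j) div Suc k = j div k" "slot k n (0, j) mod Suc k = Suc (j mod k)"
    and "i > 0 \<Longrightarrow> slot k n (i, j) div Suc k = j * n + (i - 1)"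
    and "i > 0 \<Longrightarrow> slot k n (i, j) mod Suc k = 0"
proof -
  have lt: "Suc (j mod k) < Suc k" using assms by simp
  have s: "slot k n (0, j) = Suc (j mod k) + j div k * Suc k" by (simp add: slot_def)
  show "slot k n (0, j) div Suc k = j div k"
    unfolding s using lt by (subst div_mult_self1) auto
  show "slot k n (0, j) mod Suc k = Suc (j mod k)"
    unfolding s using lt by (subst mod_mult_self1) auto
  show "i > 0 \<Longrightarrow> slot k n (i, j) div Suc k = j * n + (i - 1)"
    unfolding slot_def by (simp del: mult_Suc_right)
  show "i > 0 \<Longrightarrow> slot k n (i, j) mod Suc k = 0"
    unfolding slot_def by (simp del: mult_Suc_right)
qed

lemma inj_on_slot:
  assumes "k > 0"
  shows "inj_on (slot k n) (multipartite_verts (p # replicate n m))"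
proof (rule inj_onI, clarify)
  fix i j i' j'
  assume V: "(i, j) \<in> multipartite_verts (p # replicate n m)" "(i', j') \<in> multipartite_verts (p # replicate n m)"
    and eq: "slot k n (i, j) = slot k n (i', j')"
  have dm: "slot k n (i, j) div Suc k = slot k n (i', j') div Suc k"
    "slot k n (i, j) mod Suc k = slot k n (i', j') mod Suc k" by (simp_all only: eq)
  consider "i = 0" "i' = 0" | "i = 0" "i' > 0" | "i > 0" "i' = 0" | "i > 0" "i' > 0" by blast
  then show "i = i' \<and> j = j'"
  proof cases
    case 1
    then have "j div k = j' div k" "j mod k = j' mod k" using dm by (simp_all add: slot_div_mod[OF assms])
    then show ?thesis using 1 by (metis div_mult_mod_eq)
  next
    case 4
    then have e: "j * n + (i - 1) = j' * n + (i' - 1)" using dm by (simp add: slot_div_mod[OF assms])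
    have lt: "i - 1 < n" "i' - 1 < n" using 4 V by (auto simp: multipartite_verts_eq)
    have "(j * n + (i - 1)) div n = j" "(j' * n + (i' - 1)) div n = j'"
      "(j * n + (i - 1)) mod n = i - 1" "(j' * n + (i' - 1)) mod n = i' - 1" using lt by auto
    then show ?thesis using e 4 by simp
  qed (use dm in \<open>auto simp: slot_div_mod[OF assms]\<close>)
qed

lemma slot_less_iff: 
  assumes "i > 0" "i' > 0"
  shows "slot k n (i, j) < slot k n (i', j') \<longleftrightarrow> j * n + (i - 1) < j' * n + (i' - 1)"
  using assms unfolding slot_def by (simp del: mult_Suc_right)

text \<open>The blocks before the vertex \<open>(i, j)\<close> number
  \<open>j * n + (i - 1)\<close>, and each holds \<open>k\<close> vertices of part 0, filled in
  order of \<open>l\<close>.\<close>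

lemma slot_0_less_iff:
  assumes "k > 0" "i > 0"
  shows "slot k n (0, l) < slot k n (i, j) \<longleftrightarrow> l < (j * n + (i - 1)) * k"
proof -
  let ?s = "j * n + (i - 1)"
  have "slot k n (0, l) < slot k n (i, j) \<longleftrightarrow> slot k n (0, l) < ?s * Suc k"
    using assms(2) by (simp add: slot_def)
  also have "\<dots> \<longleftrightarrow> slot k n (0, l) div Suc k < ?s" by (simp add: div_less_iff_less_mult del: mult_Suc_right)
  also have "\<dots> \<longleftrightarrow> l < ?s * k" unfolding slot_div_mod(1)[OF assms(1)] using assms(1) by (simp add: div_less_iff_less_mult)
  finally show ?thesis .
qed

section \<open>The round-robin order attains every bound\<close>

context
  fixes q :: "nat \<times> nat \<Rightarrow> real" and m n p k :: nat
  assumes arr: "colored_arrangement q (multipartite_verts (p # replicate n m)) fst m n p k" and k: "k > 0"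
    and order: "\<And>u v. u \<in> multipartite_verts (p # replicate n m) \<Longrightarrow> v \<in> multipartite_verts (p # replicate n m)
      \<Longrightarrow> q u < q v \<longleftrightarrow> slot k n u < slot k n v"
begin

interpretation colored_arrangement q "multipartite_verts (p # replicate n m)" fst m n p k
  by (rule arr)

lemma K_eq: "i \<in> J \<Longrightarrow> K i = Pair i ` {..<m}"
  unfolding K_def unfolding multipartite_verts_eq by auto

lemma K_0_eq: "K 0 = Pair 0 ` {..<p}"
  unfolding K_def unfolding multipartite_verts_eq by auto

lemma B_eq: "B = J \<times> {..<m}"
  unfolding B_def by (auto simp: K_eq)

lemma below_K:
  assumes "i \<in> J" "v \<in> multipartite_verts (p # replicate n m)"
  shows "below q (K i) v = card {j. j < m \<and> slot k n (i, j) < slot k n v}"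
proof -
  have "{y \<in> K i. q y < q v} = Pair i ` {j. j < m \<and> slot k n (i, j) < slot k n v}"
  proof -
    have "q (i, j) < q v \<longleftrightarrow> slot k n (i, j) < slot k n v" if "j < m" for j
      using that assms by (intro order) (auto simp: multipartite_verts_eq)
    then show ?thesis using K_eq[OF assms(1)] by auto
  qed
  then show ?thesis by (simp add: below_def card_image inj_on_def)
qed

text \<open>Both sides count predecessors of \<open>x\<close> through its round-robin index
  \<open>?s\<close>: there are \<open>?s\<close> vertices of \<open>B\<close> before it, each
  followed by \<open>k\<close> vertices of part 0.\<close>

lemma balanced_rest:
  assumes "x \<in> B"
  shows "below q (K 0) x = k * below q B x"
proof -
  obtain i j where x: "x = (i, j)" "i \<in> J" "j < m"
    using assms unfolding B_eq by blast
  have xV: "x \<in> multipartite_verts (p # replicate n m)" using x by (auto simp: multipartite_verts_eq)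
  let ?s = "j * n + (i - 1)"
  have sn: "?s < m * n"
  proof -
    have "?s < Suc j * n" using x by auto
    also have "\<dots> \<le> m * n" using x by (intro mult_le_mono1) simp
    finally show ?thesis .
  qed
  have "{y \<in> K 0. q y < q x} = Pair 0 ` {l. l < ?s * k}"
  proof -
    have "?s * k \<le> p" using sn by (simp add: p_eq mult.commute)
    moreover have "q (0, l) < q x \<longleftrightarrow> l < ?s * k" if "l < p" for l
    proof -
      have "(0, l) \<in> multipartite_verts (p # replicate n m)" using that by (simp add: multipartite_verts_eq)
      from order[OF this xV] show ?thesis
        unfolding x(1) using x(2) by (subst slot_0_less_iff[OF k, symmetric]) auto
    qed
    ultimately show ?thesis unfolding K_0_eq by auto
  qed
  then have 1: "below q (K 0) x = ?s * k" by (simp add: below_def card_image inj_on_def)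
  have "below q B x = card ((\<lambda>t. (Suc (t mod n), t div n)) ` {..<?s})"
  proof -
    \<comment> \<open>The map inverts the round-robin numbering: index \<open>t\<close> belongs to
      round \<open>t div n\<close> and, as parts are numbered from 1, to part
      \<open>Suc (t mod n)\<close>.\<close>
    have "{y \<in> B. q y < q x} = (\<lambda>t. (Suc (t mod n), t div n)) ` {..<?s}"
    proof (intro equalityI subsetI)
      fix y assume y: "y \<in> {y \<in> B. q y < q x}"
      then obtain i' j' where y': "y = (i', j')" "i' \<in> J" "j' < m"
        unfolding B_eq by blast
      have yV: "y \<in> multipartite_verts (p # replicate n m)" using y' by (auto simp: multipartite_verts_eq)
      have "j' * n + (i' - 1) < ?s"
        using y order[OF yV xV] x y' slot_less_iff[of i' i k n j' j] by auto
      moreover have "y = (Suc ((j' * n + (i' - 1)) mod n), (j' * n + (i' - 1)) div n)"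
      proof -
        have lt: "i' - 1 < n" using y' by auto
        have dm: "(j' * n + (i' - 1)) div n = j'" "(j' * n + (i' - 1)) mod n = i' - 1" using lt by auto
        show ?thesis unfolding y'(1) dm using y' by simp
      qed
      ultimately show "y \<in> (\<lambda>t. (Suc (t mod n), t div n)) ` {..<?s}" by blast
    next
      fix y assume "y \<in> (\<lambda>t. (Suc (t mod n), t div n)) ` {..<?s}"
      then obtain t where t: "t < ?s" "y = (Suc (t mod n), t div n)" by blast
      have n: "n > 0" using x by auto
      have "t div n < m" using t(1) sn n by (simp add: div_less_iff_less_mult)
      moreover have "t mod n < n" using n by simp
      ultimately have yB: "y \<in> B" and yV: "y \<in> multipartite_verts (p # replicate n m)"
        unfolding B_eq unfolding multipartite_verts_eq using t(2) by auto
      have "slot k n y < slot k n x"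
        unfolding t(2) x(1) using t(1) x by (subst slot_less_iff) auto
      then show "y \<in> {y \<in> B. q y < q x}" using yB order[OF yV xV] by simp
    qed
    then show ?thesis by (simp add: below_def)
  qed
  also have "\<dots> = ?s"
  proof -
    have "inj_on (\<lambda>t. (Suc (t mod n), t div n)) {..<?s}"
      by (rule inj_onI) (metis Pair_inject Suc_inject div_mult_mod_eq)
    then show ?thesis by (simp add: card_image)
  qed
  finally show ?thesis using 1 by simp
qed

text \<open>Within a round part \<open>i\<close> comes before part \<open>j\<close>, and
  \<open>j\<close> comes before part \<open>i\<close> of the next round, so the two parts alternate
  starting with \<open>i\<close>.\<close>

lemma balanced_classes:
  assumes "i \<in> J" "j \<in> J" "i < j" "v \<in> multipartite_verts (p # replicate n m)"
  shows "below q (K j) v \<le> below q (K i) v \<and> below q (K i) v \<le> Suc (below q (K j) v)"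
proof
  let ?S = "\<lambda>i. {l. l < m \<and> slot k n (i, l) < slot k n v}"
  have "slot k n (i, l) < slot k n (j, l)" for l
    using assms by (subst slot_less_iff) auto
  then have "?S j \<subseteq> ?S i" using less_trans by blast
  then show "below q (K j) v \<le> below q (K i) v"
    using assms by (simp add: below_K card_mono)
  have "slot k n (j, l) < slot k n (i, Suc l)" for l
    using assms by (subst slot_less_iff) auto
  \<comment> \<open>Every vertex of part \<open>i\<close> below \<open>v\<close> except that of
    round 0 is preceded by the vertex of part \<open>j\<close> one round earlier; round 0 accounts
    for the extra one.\<close>
  then have "l \<in> insert 0 (Suc ` ?S j)" if "l \<in> ?S i" for l
    using that by (cases l) (auto intro: less_trans)
  then have "card (?S i) \<le> card (insert 0 (Suc ` ?S j))" by (intro card_mono) auto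
  also have "\<dots> \<le> Suc (card (?S j))" by (simp add: card_insert_if card_image)
  finally show "below q (K i) v \<le> Suc (below q (K j) v)"
    using assms by (simp add: below_K)
qed

text \<open>From the vertex \<open>(i, a)\<close> exactly the rounds before \<open>a\<close> are
  visible in both parts: \<open>(j, a)\<close> comes later in the same round, and
  \<open>(i, a)\<close> is not below itself.\<close>

lemma balanced_class_points:
  assumes "i \<in> J" "j \<in> J" "i < j" "x \<in> K i"
  shows "below q (K j) x = below q (K i) x"
proof -
  obtain a where x: "x = (i, a)" "a < m" using assms(4) K_eq[OF assms(1)] by blast
  have xV: "x \<in> multipartite_verts (p # replicate n m)" using assms(4) by (simp add: K_def)
  have "slot k n (l, b) < slot k n x \<longleftrightarrow> b < a" if "l \<in> {i, j}" for l b
  proof -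
    have l: "1 \<le> l" "i \<le> l" "l \<le> n" using that assms by auto
    have "slot k n (l, b) < slot k n x \<longleftrightarrow> b * n + (l - 1) < a * n + (i - 1)"
      unfolding x using l assms by (subst slot_less_iff) auto
    also have "\<dots> \<longleftrightarrow> b < a"
    proof
      assume "b < a"
      then have "Suc b * n \<le> a * n" by (intro mult_le_mono1) simp
      then show "b * n + (l - 1) < a * n + (i - 1)" using l by simp
    next
      assume *: "b * n + (l - 1) < a * n + (i - 1)"
      show "b < a"
      proof (rule ccontr)
        assume "\<not> b < a"
        then have "a * n \<le> b * n" by (intro mult_le_mono1) simp
        moreover have "i - 1 \<le> l - 1" using l by simp
        ultimately show False using * by linarith
      qed
    qed
    finally show ?thesis .
  qed
  then show ?thesis using assms xV by (simp add: below_K)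
qed

lemma slot_order_optimal: "noncrossing = noncrossing_max"
  using balanced_rest balanced_classes balanced_class_points by (rule noncrossing_eq)

end

theorem theorem2:
  fixes m n p :: nat
  assumes "m > 0" and "n > 0" and "p > 0" and "m * n dvd p"
  shows "real (nu1_multipartite (p # replicate n m)) =
    phi (real m) (real n) (real p) - 1/12 * (real m)^2 * (real n)^2 + 1/12 * (real p)^2"
proof -
  obtain k where p: "p = k * (m * n)" using assms(4) by (metis dvdE mult.commute)
  have k: "k > 0" using p assms(3) by (cases k) auto
  let ?V = "multipartite_verts (p # replicate n m)" and ?E = "multipartite_edges (p # replicate n m)"
  let ?min = "phi (real m) (real n) (real p) - 1/12 * (real m)^2 * (real n)^2 + 1/12 * (real p)^2"
  have fin: "finite ?V"
    by (rule finite_subset[of _ "{..n} \<times> {..<p + m}"]) (auto simp: multipartite_verts_eq)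
  have E: "?E = {{u, v} | u v. u \<in> ?V \<and> v \<in> ?V \<and> fst u \<noteq> fst v}" by (simp add: multipartite_edges_def)
  have lower: "?min \<le> real (card (crossings ?E f))" if f: "outerplanar_drawing ?V ?E f" for f
  proof -
    obtain \<theta> z r where \<theta>: "r > 0" "inj_on \<theta> ?V" "\<theta> ` ?V \<subseteq> {0..<2 * pi}"
      "\<And>v. v \<in> ?V \<Longrightarrow> f v = circle_point z r (\<theta> v)"
      using outerplanar_drawing_angles[OF f] by metis
    interpret colored_arrangement \<theta> ?V fst m n p k
      by (rule colored_arrangement_multipartite[OF \<theta>(2) p])
    have "8 * real (card (crossings ?E f)) = crossing_tuples"
      unfolding crossing_tuples_def
      by (rule crossings_eq_interlaced_tuples[OF fin \<theta>(2,3,1,4) E])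
    then show ?thesis
      using crossing_tuples_min_crossings noncrossing_le unfolding min_crossings_def[symmetric] by linarith
  qed
  have edge: "e \<subseteq> ?V \<and> card e = 2" if "e \<in> ?E" for e
    using that unfolding E by (auto simp: card_2_iff)
  obtain \<theta> where \<theta>: "\<theta> ` ?V \<subseteq> {0..<2 * pi}" "outerplanar_drawing ?V ?E (\<lambda>v. cis (\<theta> v))"
    "\<And>u v. u \<in> ?V \<Longrightarrow> v \<in> ?V \<Longrightarrow> \<theta> u < \<theta> v \<longleftrightarrow> slot k n u < slot k n v"
    using outerplanar_drawing_with_order[OF fin inj_on_slot[OF k] edge] by metis
  have inj: "inj_on \<theta> ?V"
  proof (rule inj_onI)
    fix u v assume uv: "u \<in> ?V" "v \<in> ?V" "\<theta> u = \<theta> v"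
    then have "slot k n u = slot k n v" using \<theta>(3)[of u v] \<theta>(3)[of v u] by simp
    then show "u = v" using inj_on_slot[OF k] uv by (meson inj_onD)
  qed
  have upper: "real (card (crossings ?E (\<lambda>v. cis (\<theta> v)))) = ?min"
  proof -
    have arr: "colored_arrangement \<theta> ?V fst m n p k"
      by (rule colored_arrangement_multipartite[OF inj p])
    then interpret colored_arrangement \<theta> ?V fst m n p k .
    have "8 * real (card (crossings ?E (\<lambda>v. cis (\<theta> v)))) = crossing_tuples"
      unfolding crossing_tuples_def
      by (rule crossings_eq_interlaced_tuples[OF fin inj \<theta>(1), of 1 _ 0, OF _ _ E]) (auto simp: circle_point_def)
    then show ?thesis
      using crossing_tuples_min_crossings slot_order_optimal[OF arr k \<theta>(3)] unfolding min_crossings_def by simp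
  qed
  \<comment> \<open>The constructed drawing has exactly \<open>?min\<close> crossings, so the lower
    bound \<open>?min\<close> for all drawings makes its count the least one.\<close>
  have "nu1_multipartite (p # replicate n m) = card (crossings ?E (\<lambda>v. cis (\<theta> v)))"
    unfolding nu1_multipartite_def outerplanar_crossing_number_def
  proof (rule Least_equality)
    show "\<exists>f. outerplanar_drawing ?V ?E f \<and> card (crossings ?E f) = card (crossings ?E (\<lambda>v. cis (\<theta> v)))"
      using \<theta>(2) by blast
    show "card (crossings ?E (\<lambda>v. cis (\<theta> v))) \<le> l"
      if ex: "\<exists>f. outerplanar_drawing ?V ?E f \<and> card (crossings ?E f) = l" for l
    proof -
      obtain f where f: "outerplanar_drawing ?V ?E f" "card (crossings ?E f) = l" using ex by blast
      show ?thesis using lower[OF f(1)] f(2) upper by linarith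
    qed
  qed
  then show ?thesis using upper by simp
qed

end
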